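(* Let $\nabla$ be a biinvariant, torsion-free Koszul connection on $T\mathcal H(n,\mathbb R)$. Then there exist $l\in W^*$ and a symmetric bilinear map $\Omega:W\times W\to V$ such that $$\nabla_xy=\frac12[x,y]+l(x_w)y+l(y_w)x+\Omega(x_w,y_w)\qquad\text{for all }x,y\in\mathfrak h.$$ In particular $\nabla$ is $\mathcal P$-complete.
   Context: $\mathcal H(n,\mathbb R)=\left\{\begin{bmatrix}1&a^T&c\\0&I_n&b\\0&0&1\end{bmatrix}\mid c\in\mathbb R,\ a,b\in\mathbb R^n\right\}\subset GL(n+2,\mathbb R)$, a 2-step nilpotent Lie group of dimension $2n+1$ with Lie algebra $\mathfrak h$. With $e_{j,k}$ the $(n+2)\times(n+2)$ matrix having a single nonzero entry $1$ in position $(j,k)$, $W$ is the span of $e_{1,k}$ and $e_{k,n+2}$ for $k=2,\dots,n+1$, and $V=\langle e_{1,n+2}\rangle$. Then $\mathfrak h=W\oplus V$ and $V$ is the center and the derived subalgebra of $\mathfrak h$; $x_w\in W$, $x_v$ denote the components of $x\in\mathfrak h$. Elements of $\mathfrak h$ are identified with left invariant vector fields. A Koszul connection (linear connection on the tangent bundle of a Lie group) is biinvariant if it is both left and right invariant. For a Koszul connection $\nabla$ on a manifold $M$ and $v\in TM$ let $\gamma_v:I_v\to M$ be the maximal $\nabla$-geodesic with $\dot\gamma_v(0)=v$, $\mathbb{C}I_v=\{t+is:t\in I_v,\ s\in\mathbb R\}$ and $\Omega_v:\mathbb{C}I_v\to TM$, $\Omega_v(t+is)=s\dot\gamma_v(t)$.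 A polarization on an even-dimensional smooth manifold $X$ is a smooth complex subbundle $P\subset\mathbb{C}TX$ closed under Lie brackets of local smooth sections with $\operatorname{rank}_{\mathbb C}P=\frac12\dim X$. An ac-polarization on $TM$ is a polarization $P$ on the manifold $TM$ with $(\Omega_v)_*(T^{1,0}(\mathbb{C}I_v))\subset P$ for all $v\in TM$. $\nabla$ is $\mathcal P$-complete if an ac-polarization exists on $TM$. *)

theory Defs
  imports "HOL-Analysis.Analysis"
begin

section \<open>Smooth maps and tangent vectors on embedded submanifolds of Euclidean spaces\<close>

text \<open>
  Manifolds are represented as embedded submanifolds \<open>M\<close> of a Euclidean space. A map on
  \<open>M\<close> is smooth if it extends locally to a smooth map on an open subset of the ambient
  space. The tangent space of \<open>M\<close> at \<open>p\<close> is a linear subspace of the ambient space, and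
  the tangent bundle is a subset of the product of the ambient space with itself, hence
  again a manifold of the same kind.
\<close>

primrec Ck_on :: "nat \<Rightarrow> 'a::euclidean_space set \<Rightarrow> ('a \<Rightarrow> 'b::real_normed_vector) \<Rightarrow> bool" where
  "Ck_on 0 U f \<longleftrightarrow> continuous_on U f"
| "Ck_on (Suc k) U f \<longleftrightarrow>
     (\<forall>x\<in>U. f differentiable (at x)) \<and> (\<forall>v. Ck_on k U (\<lambda>x. frechet_derivative f (at x) v))"

definition smooth_on :: "'a::euclidean_space set \<Rightarrow> ('a \<Rightarrow> 'b::real_normed_vector) \<Rightarrow> bool" where
  "smooth_on U f \<longleftrightarrow> (\<forall>k. Ck_on k U f)"

definition smooth_map_on :: "'a::euclidean_space set \<Rightarrow> ('a \<Rightarrow> 'b::real_normed_vector) \<Rightarrow> bool" where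
  "smooth_map_on M f \<longleftrightarrow>
     (\<forall>p\<in>M. \<exists>U g. open U \<and> p \<in> U \<and> smooth_on U g \<and> (\<forall>q\<in>M \<inter> U. g q = f q))"

definition tangent_space :: "'a::euclidean_space set \<Rightarrow> 'a \<Rightarrow> 'a set" where
  "tangent_space M p = {v. \<exists>(c::real \<Rightarrow> 'a) e. e > 0 \<and> smooth_on {-e<..<e} c \<and>
      c ` {-e<..<e} \<subseteq> M \<and> c 0 = p \<and> (c has_vector_derivative v) (at 0)}"

definition tangent_bundle :: "'a::euclidean_space set \<Rightarrow> ('a \<times> 'a) set" where
  "tangent_bundle M = Sigma M (tangent_space M)"

text \<open>
  The derivative \<open>frechet_derivative f (at p within M)\<close> is in general not unique as a linear
  map on the ambient space, but its values on the tangent space of \<open>M\<close> at \<open>p\<close> are: they are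
  the derivatives of \<open>f\<close> along curves in \<open>M\<close>. It is only ever applied to tangent vectors.
\<close>

definition tangent_deriv ::
    "'a::euclidean_space set \<Rightarrow> ('a \<Rightarrow> 'b::real_normed_vector) \<Rightarrow> 'a \<Rightarrow> 'a \<Rightarrow> 'b" where
  "tangent_deriv M f p v = frechet_derivative f (at p within M) v"

definition bracket_at ::
    "'a::euclidean_space set \<Rightarrow> ('a \<Rightarrow> 'a) \<Rightarrow> ('a \<Rightarrow> 'a) \<Rightarrow> 'a \<Rightarrow> 'a" where
  "bracket_at M X Y p = tangent_deriv M Y p (X p) - tangent_deriv M X p (Y p)"

section \<open>Koszul connections\<close>

text \<open>
  Vector fields on \<open>M\<close> are functions on the ambient space that vanish outside \<open>M\<close>, so that
  equality of vector fields is equality of functions.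
\<close>

definition vector_fields :: "'a::euclidean_space set \<Rightarrow> ('a \<Rightarrow> 'a) set" where
  "vector_fields M = {X. smooth_map_on M X \<and> (\<forall>p\<in>M. X p \<in> tangent_space M p) \<and>
      (\<forall>p. p \<notin> M \<longrightarrow> X p = 0)}"

definition vf_bracket ::
    "'a::euclidean_space set \<Rightarrow> ('a \<Rightarrow> 'a) \<Rightarrow> ('a \<Rightarrow> 'a) \<Rightarrow> 'a \<Rightarrow> 'a" where
  "vf_bracket M X Y = (\<lambda>p. if p \<in> M then bracket_at M X Y p else 0)"

type_synonym 'a connection = "('a \<Rightarrow> 'a) \<Rightarrow> ('a \<Rightarrow> 'a) \<Rightarrow> 'a \<Rightarrow> 'a"

text \<open>Homogeneity over the reals in the second argument is the Leibniz rule for constant \<open>f\<close>.\<close>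

definition koszul_connection :: "'a::euclidean_space set \<Rightarrow> 'a connection \<Rightarrow> bool" where
  "koszul_connection M nabla \<longleftrightarrow>
     (\<forall>X\<in>vector_fields M. \<forall>Y\<in>vector_fields M. nabla X Y \<in> vector_fields M) \<and>
     (\<forall>X\<in>vector_fields M. \<forall>X'\<in>vector_fields M. \<forall>Y\<in>vector_fields M.
        nabla (\<lambda>p. X p + X' p) Y = (\<lambda>p. nabla X Y p + nabla X' Y p)) \<and>
     (\<forall>f::'a \<Rightarrow> real. smooth_map_on M f \<longrightarrow>
        (\<forall>X\<in>vector_fields M. \<forall>Y\<in>vector_fields M.
           nabla (\<lambda>p. f p *\<^sub>R X p) Y = (\<lambda>p. f p *\<^sub>R nabla X Y p))) \<and>
     (\<forall>X\<in>vector_fields M. \<forall>Y\<in>vector_fields M. \<forall>Y'\<in>vector_fields M.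
        nabla X (\<lambda>p. Y p + Y' p) = (\<lambda>p. nabla X Y p + nabla X Y' p)) \<and>
     (\<forall>f::'a \<Rightarrow> real. smooth_map_on M f \<longrightarrow>
        (\<forall>X\<in>vector_fields M. \<forall>Y\<in>vector_fields M.
           nabla X (\<lambda>p. f p *\<^sub>R Y p) =
             (\<lambda>p. tangent_deriv M f p (X p) *\<^sub>R Y p + f p *\<^sub>R nabla X Y p)))"

definition torsion_free :: "'a::euclidean_space set \<Rightarrow> 'a connection \<Rightarrow> bool" where
  "torsion_free M nabla \<longleftrightarrow>
     (\<forall>X\<in>vector_fields M. \<forall>Y\<in>vector_fields M.
        (\<lambda>p. nabla X Y p - nabla Y X p) = vf_bracket M X Y)"

text \<open>Here \<open>\<phi>\<close> is meant to be a diffeomorphism of \<open>M\<close> onto itself.\<close>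

definition pushforward ::
    "'a::euclidean_space set \<Rightarrow> ('a \<Rightarrow> 'a) \<Rightarrow> ('a \<Rightarrow> 'a) \<Rightarrow> 'a \<Rightarrow> 'a" where
  "pushforward M \<phi> X = (\<lambda>p. if p \<in> M
      then tangent_deriv M \<phi> (inv_into M \<phi> p) (X (inv_into M \<phi> p)) else 0)"

definition invariant_under ::
    "'a::euclidean_space set \<Rightarrow> ('a \<Rightarrow> 'a) \<Rightarrow> 'a connection \<Rightarrow> bool" where
  "invariant_under M \<phi> nabla \<longleftrightarrow>
     (\<forall>X\<in>vector_fields M. \<forall>Y\<in>vector_fields M.
        nabla (pushforward M \<phi> X) (pushforward M \<phi> Y) = pushforward M \<phi> (nabla X Y))"

section \<open>Geodesics\<close>

definition velocity :: "(real \<Rightarrow> 'a::real_normed_vector) \<Rightarrow> real \<Rightarrow> 'a" where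
  "velocity \<gamma> t = vector_derivative \<gamma> (at t)"

definition fields_along ::
    "'a::euclidean_space set \<Rightarrow> real set \<Rightarrow> (real \<Rightarrow> 'a) \<Rightarrow> (real \<Rightarrow> 'a) set" where
  "fields_along M I \<gamma> = {V. smooth_on I V \<and> (\<forall>t\<in>I. V t \<in> tangent_space M (\<gamma> t))}"

text \<open>
  The usual characterization of the covariant derivative \<open>D\<close> along a curve \<open>\<gamma>\<close>: additivity,
  Leibniz rule, and compatibility with \<open>nabla\<close> on vector fields of the form \<open>Y \<circ> \<gamma>\<close>. These
  properties determine \<open>D\<close> uniquely on \<open>I\<close>. In the last clause \<open>nabla X Y\<close> at \<open>\<gamma> t\<close> depends
  on \<open>X\<close> only through its value at that point, which is the velocity of \<open>\<gamma>\<close>.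
\<close>

definition covariant_derivative_along ::
    "'a::euclidean_space set \<Rightarrow> 'a connection \<Rightarrow> real set \<Rightarrow> (real \<Rightarrow> 'a) \<Rightarrow>
      ((real \<Rightarrow> 'a) \<Rightarrow> real \<Rightarrow> 'a) \<Rightarrow> bool" where
  "covariant_derivative_along M nabla I \<gamma> D \<longleftrightarrow>
     (\<forall>V\<in>fields_along M I \<gamma>. D V \<in> fields_along M I \<gamma>) \<and>
     (\<forall>V\<in>fields_along M I \<gamma>. \<forall>V'\<in>fields_along M I \<gamma>. \<forall>t\<in>I.
        D (\<lambda>s. V s + V' s) t = D V t + D V' t) \<and>
     (\<forall>f::real \<Rightarrow> real. smooth_on I f \<longrightarrow> (\<forall>V\<in>fields_along M I \<gamma>. \<forall>t\<in>I.
        D (\<lambda>s. f s *\<^sub>R V s) t = deriv f t *\<^sub>R V t + f t *\<^sub>R D V t)) \<and>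
     (\<forall>X\<in>vector_fields M. \<forall>Y\<in>vector_fields M. \<forall>t\<in>I.
        X (\<gamma> t) = velocity \<gamma> t \<longrightarrow> D (\<lambda>s. Y (\<gamma> s)) t = nabla X Y (\<gamma> t))"

definition geodesic_on ::
    "'a::euclidean_space set \<Rightarrow> 'a connection \<Rightarrow> real set \<Rightarrow> (real \<Rightarrow> 'a) \<Rightarrow> bool" where
  "geodesic_on M nabla I \<gamma> \<longleftrightarrow>
     open I \<and> is_interval I \<and> smooth_on I \<gamma> \<and> \<gamma> ` I \<subseteq> M \<and>
     (\<exists>D. covariant_derivative_along M nabla I \<gamma> D \<and> (\<forall>t\<in>I. D (velocity \<gamma>) t = 0))"

definition maximal_geodesic ::
    "'a::euclidean_space set \<Rightarrow> 'a connection \<Rightarrow> 'a \<times> 'a \<Rightarrow> real set \<Rightarrow> (real \<Rightarrow> 'a) \<Rightarrow> bool" where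
  "maximal_geodesic M nabla v I \<gamma> \<longleftrightarrow>
     geodesic_on M nabla I \<gamma> \<and> 0 \<in> I \<and> (\<gamma> 0, velocity \<gamma> 0) = v \<and>
     (\<forall>J \<delta>. geodesic_on M nabla J \<delta> \<and> I \<subseteq> J \<and> (\<forall>t\<in>I. \<delta> t = \<gamma> t) \<longrightarrow> J = I)"

section \<open>Complexified tangent bundles and polarizations\<close>

text \<open>The pair \<open>(a, b)\<close> stands for the element \<open>a + i b\<close> of the complexification.\<close>

definition cscale :: "complex \<Rightarrow> 'a::real_vector \<times> 'a \<Rightarrow> 'a \<times> 'a" where
  "cscale z \<xi> = (Re z *\<^sub>R fst \<xi> - Im z *\<^sub>R snd \<xi>, Re z *\<^sub>R snd \<xi> + Im z *\<^sub>R fst \<xi>)"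

interpretation cplx: vector_space cscale
  by unfold_locales (auto simp: cscale_def algebra_simps)

definition complex_tangent_space :: "'a::euclidean_space set \<Rightarrow> 'a \<Rightarrow> ('a \<times> 'a) set" where
  "complex_tangent_space X p = tangent_space X p \<times> tangent_space X p"

text \<open>The complex bilinear extension of the bracket of real vector fields.\<close>

definition complex_bracket_at ::
    "'a::euclidean_space set \<Rightarrow> ('a \<Rightarrow> 'a \<times> 'a) \<Rightarrow> ('a \<Rightarrow> 'a \<times> 'a) \<Rightarrow> 'a \<Rightarrow> 'a \<times> 'a" where
  "complex_bracket_at X Z Z' p =
     (bracket_at X (fst \<circ> Z) (fst \<circ> Z') p - bracket_at X (snd \<circ> Z) (snd \<circ> Z') p,
      bracket_at X (fst \<circ> Z) (snd \<circ> Z') p + bracket_at X (snd \<circ> Z) (fst \<circ> Z') p)"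

definition smooth_complex_subbundle ::
    "'a::euclidean_space set \<Rightarrow> ('a \<Rightarrow> ('a \<times> 'a) set) \<Rightarrow> bool" where
  "smooth_complex_subbundle X P \<longleftrightarrow>
     (\<forall>p\<in>X. cplx.subspace (P p) \<and> P p \<subseteq> complex_tangent_space X p) \<and>
     (\<forall>p\<in>X. \<exists>U r. \<exists>Z::nat \<Rightarrow> 'a \<Rightarrow> 'a \<times> 'a. open U \<and> p \<in> U \<and>
        (\<forall>i<r. smooth_map_on (X \<inter> U) (Z i)) \<and>
        (\<forall>q\<in>X \<inter> U. inj_on (\<lambda>i. Z i q) {..<r} \<and>
           cplx.independent ((\<lambda>i. Z i q) ` {..<r}) \<and>
           cplx.span ((\<lambda>i. Z i q) ` {..<r}) = P q))"

definition involutive :: "'a::euclidean_space set \<Rightarrow> ('a \<Rightarrow> ('a \<times> 'a) set) \<Rightarrow> bool" where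
  "involutive X P \<longleftrightarrow>
     (\<forall>U Z Z'. open U \<and> smooth_map_on (X \<inter> U) Z \<and> smooth_map_on (X \<inter> U) Z' \<and>
        (\<forall>q\<in>X \<inter> U. Z q \<in> P q \<and> Z' q \<in> P q) \<longrightarrow>
        (\<forall>q\<in>X \<inter> U. complex_bracket_at X Z Z' q \<in> P q))"

definition polarization :: "'a::euclidean_space set \<Rightarrow> ('a \<Rightarrow> ('a \<times> 'a) set) \<Rightarrow> bool" where
  "polarization X P \<longleftrightarrow>
     smooth_complex_subbundle X P \<and> involutive X P \<and>
     (\<forall>p\<in>X. 2 * cplx.dim (P p) = dim (tangent_space X p))"

definition complexified_interval :: "real set \<Rightarrow> complex set" where
  "complexified_interval I = {z. Re z \<in> I}"

definition Omega_map :: "(real \<Rightarrow> 'a::real_normed_vector) \<Rightarrow> complex \<Rightarrow> 'a \<times> 'a" where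
  "Omega_map \<gamma> z = (\<gamma> (Re z), Im z *\<^sub>R velocity \<gamma> (Re z))"

text \<open>
  The \<open>(1,0)\<close>-space of an open subset of the complex plane, at any of its points: the
  \<open>i\<close>-eigenspace, in the complexification of the real tangent space \<open>\<complex>\<close>, of the
  complex structure \<open>J u = i u\<close>.
\<close>

definition T10 :: "(complex \<times> complex) set" where
  "T10 = {\<xi>. map_prod ((*) \<i>) ((*) \<i>) \<xi> = cscale \<i> \<xi>}"

definition ac_polarization ::
    "'a::euclidean_space set \<Rightarrow> 'a connection \<Rightarrow> ('a \<times> 'a \<Rightarrow> (('a \<times> 'a) \<times> ('a \<times> 'a)) set) \<Rightarrow> bool" where
  "ac_polarization M nabla P \<longleftrightarrow>
     polarization (tangent_bundle M) P \<and>
     (\<forall>v\<in>tangent_bundle M. \<forall>I \<gamma>. maximal_geodesic M nabla v I \<gamma> \<longrightarrow>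
        (\<forall>z\<in>complexified_interval I.
           let d\<Omega> = frechet_derivative (Omega_map \<gamma>) (at z)
           in map_prod d\<Omega> d\<Omega> ` T10 \<subseteq> P (Omega_map \<gamma> z)))"

definition P_complete :: "'a::euclidean_space set \<Rightarrow> 'a connection \<Rightarrow> bool" where
  "P_complete M nabla \<longleftrightarrow> (\<exists>P. ac_polarization M nabla P)"

section \<open>The Heisenberg group\<close>

text \<open>Row and column indices \<open>1\<close>, \<open>2, \<dots>, n+1\<close>, \<open>n+2\<close>, where \<open>n = CARD('n)\<close>.\<close>

datatype 'n hidx = First | Mid 'n | Last

instance hidx :: (finite) finite
proof
  have "(UNIV :: 'a hidx set) = insert First (insert Last (range Mid))"
    by (auto intro: hidx.exhaust)
  then show "finite (UNIV :: 'a hidx set)"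
    by (metis finite finite_imageI finite_insert)
qed

type_synonym 'n hmat = "real ^ 'n hidx ^ 'n hidx"

definition heis_mat :: "real ^ 'n::finite \<Rightarrow> real ^ 'n \<Rightarrow> real \<Rightarrow> 'n hmat" where
  "heis_mat a b c = (\<chi> i j. case i of
      First \<Rightarrow> (case j of First \<Rightarrow> 1 | Mid k \<Rightarrow> a $ k | Last \<Rightarrow> c)
    | Mid k \<Rightarrow> (case j of First \<Rightarrow> 0 | Mid k' \<Rightarrow> (if k = k' then 1 else 0) | Last \<Rightarrow> b $ k)
    | Last \<Rightarrow> (case j of First \<Rightarrow> 0 | Mid k \<Rightarrow> 0 | Last \<Rightarrow> 1))"

definition heis :: "'n::finite hmat set" where
  "heis = {heis_mat a b c | a b c. True}"

definition heis_alg :: "'n::finite hmat set" where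
  "heis_alg = tangent_space heis (mat 1)"

definition unit_mat :: "'n::finite hidx \<Rightarrow> 'n hidx \<Rightarrow> 'n hmat" where
  "unit_mat j k = (\<chi> r s. if r = j \<and> s = k then 1 else 0)"

definition heis_W :: "'n::finite hmat set" where
  "heis_W = span (range (\<lambda>k. unit_mat First (Mid k)) \<union> range (\<lambda>k. unit_mat (Mid k) Last))"

definition heis_V :: "'n::finite hmat set" where
  "heis_V = span {unit_mat First Last}"

definition W_part :: "'n::finite hmat \<Rightarrow> 'n hmat" where
  "W_part x = (THE w. w \<in> heis_W \<and> x - w \<in> heis_V)"

definition mat_bracket :: "'n::finite hmat \<Rightarrow> 'n hmat \<Rightarrow> 'n hmat" where
  "mat_bracket x y = x ** y - y ** x"

definition left_invariant_field :: "'n::finite hmat \<Rightarrow> 'n hmat \<Rightarrow> 'n hmat" where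
  "left_invariant_field x = (\<lambda>g. if g \<in> heis then g ** x else 0)"

definition biinvariant :: "'n::finite hmat connection \<Rightarrow> bool" where
  "biinvariant nabla \<longleftrightarrow>
     (\<forall>g\<in>heis. invariant_under heis (\<lambda>h. g ** h) nabla \<and> invariant_under heis (\<lambda>h. h ** g) nabla)"

definition dual_on :: "'a::real_vector set \<Rightarrow> ('a \<Rightarrow> real) set" where
  "dual_on W = {l. \<forall>x\<in>W. \<forall>y\<in>W. \<forall>r. l (x + y) = l x + l y \<and> l (r *\<^sub>R x) = r * l x}"

definition symmetric_bilinear_on ::
    "'a::real_vector set \<Rightarrow> 'a set \<Rightarrow> ('a \<Rightarrow> 'a \<Rightarrow> 'a) \<Rightarrow> bool" where
  "symmetric_bilinear_on W V \<Omega> \<longleftrightarrow>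
     (\<forall>x\<in>W. \<forall>y\<in>W. \<Omega> x y \<in> V \<and> \<Omega> x y = \<Omega> y x) \<and>
     (\<forall>x\<in>W. \<forall>x'\<in>W. \<forall>y\<in>W. \<forall>r.
        \<Omega> (x + x') y = \<Omega> x y + \<Omega> x' y \<and> \<Omega> (r *\<^sub>R x) y = r *\<^sub>R \<Omega> x y)"

end

theory Submission
  imports Defs "HOL-Complex_Analysis.Cauchy_Integral_Formula"
begin

text \<open>
  A biinvariant connection is determined by a bilinear product \<open>mu\<close> on the Lie algebra that is
  invariant under the adjoint action \<open>x \<mapsto> x + [x, z]\<close>; absence of torsion says that its
  antisymmetric part is half the bracket. Comparing the parts of the invariance equation that are
  linear and quadratic in \<open>z\<close>, and inserting the central vector \<open>e\<close> as an argument, gives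
  \<open>mu e e = 0\<close>, \<open>mu x e = l x * e\<close>, and finally that \<open>mu x y - l x * y - l y * x\<close> brackets to zero
  with everything, so it is central (\<open>Omega_central\<close>). This is the formula for the connection.

  For the polarization, the Heisenberg group is regarded as an affine subspace \<open>M = 1 + S\<close> of the
  space of matrices. In the frame of constant fields the connection has constant Christoffel
  symbols (\<open>nabla_constant_field\<close>), and a geodesic with velocity \<open>w\<close> satisfies
  \<open>w' = - 2 * l w * w + B w w\<close> with a symmetric bilinear \<open>B\<close> whose values are central and hence
  killed by \<open>l\<close> and \<open>B\<close>. Look for a polarization of \<open>TM = M \<times> S\<close> that is invariant under
  translations of \<open>M\<close> and transversal to \<open>M\<close>: it is given by the vectors
  \<open>(- dK \<eta>, \<eta>)\<close> for complex \<open>\<eta>\<close>, where \<open>K\<close> is a complex valued potential on the fibre \<open>S\<close>. Such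
  a distribution has the right rank and is involutive because second derivatives are symmetric
  (\<open>polarization_P\<close>). It contains the images of the (1,0)-vectors of complexified geodesics if at
  \<open>X = s w\<close> the derivative of \<open>K\<close> sends \<open>s w' - \<i> w\<close> to \<open>- w\<close>. The ansatz
  \<open>K X = k (l X) * X + (k (l X))\<^sup>2 / 2 * B X X\<close> reduces this to the scalar equation
  \<open>(2 r + \<i>) (r k)' = 1\<close>, solved by \<open>k r = Ln (1 - 2 \<i> r) / (2 r)\<close>, which is smooth on the
  whole real line (\<open>complex_time_profile_exists\<close>, \<open>potential_deriv_geodesic\<close>,
  \<open>P_complete_affine\<close>).
\<close>

section \<open>Calculus of smooth maps\<close>

lemma frechet_derivative_eqI:
  "(f has_derivative D) (at x) \<Longrightarrow> frechet_derivative f (at x) = D"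
  by (rule frechet_derivative_at[symmetric])

lemma Ck_on_cong:
  assumes "open U" "Ck_on k U f" "\<And>x. x \<in> U \<Longrightarrow> f x = g x"
  shows "Ck_on k U g"
  using assms(2,3)
proof (induction k arbitrary: f g)
  case 0
  then show ?case by (simp cong: continuous_on_cong)
next
  case (Suc k)
  have D: "(g has_derivative frechet_derivative f (at x)) (at x)" if "x \<in> U" for x
  proof -
    have "(f has_derivative frechet_derivative f (at x)) (at x)"
      using Suc.prems(1) that by (simp add: frechet_derivative_works)
    then show ?thesis
      by (rule has_derivative_transform_within_open[OF _ \<open>open U\<close> that]) (use Suc.prems(2) in auto)
  qed
  have "Ck_on k U (\<lambda>x. frechet_derivative g (at x) v)" for v
    by (rule Suc.IH[where f="\<lambda>x. frechet_derivative f (at x) v"])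
      (use Suc.prems(1) frechet_derivative_eqI[OF D] in auto)
  then show ?case using D by (auto simp: differentiable_def)
qed

lemma Ck_on_Suc_intro:
  assumes "open U" "\<And>x. x \<in> U \<Longrightarrow> (f has_derivative D x) (at x)"
    "\<And>v. Ck_on k U (\<lambda>x. D x v)"
  shows "Ck_on (Suc k) U f"
proof -
  have "Ck_on k U (\<lambda>x. frechet_derivative f (at x) v)" for v
    by (rule Ck_on_cong[OF assms(1) assms(3)[of v]]) (simp add: frechet_derivative_eqI[OF assms(2)])
  then show ?thesis using assms(2) by (auto simp: differentiable_def)
qed

lemma Ck_on_Suc_has_derivative:
  "Ck_on (Suc k) U f \<Longrightarrow> x \<in> U \<Longrightarrow> (f has_derivative frechet_derivative f (at x)) (at x)"
  by (simp add: frechet_derivative_works)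

lemma Ck_on_SucD: "Ck_on (Suc k) U f \<Longrightarrow> Ck_on k U f"
proof (induction k arbitrary: f)
  case 0
  then show ?case
    by (simp add: differentiable_imp_continuous_on differentiable_on_def
        differentiable_at_withinI)
next
  case (Suc k)
  then show ?case by (metis Ck_on.simps(2))
qed

lemma Ck_on_const: "Ck_on k U (\<lambda>x. c)"
  by (induction k arbitrary: c) auto

lemma Ck_on_add:
  assumes "open U"
  shows "Ck_on k U f \<Longrightarrow> Ck_on k U g \<Longrightarrow> Ck_on k U (\<lambda>x. f x + g x)"
proof (induction k arbitrary: f g)
  case (Suc k)
  show ?case
  proof (rule Ck_on_Suc_intro[OF assms])
    show "((\<lambda>x. f x + g x) has_derivative
        (\<lambda>v. frechet_derivative f (at x) v + frechet_derivative g (at x) v)) (at x)" if "x \<in> U" for x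
      using Suc.prems that by (intro has_derivative_add Ck_on_Suc_has_derivative)
  qed (use Suc in auto)
qed (auto intro: continuous_intros)

lemma Ck_on_bounded_linear:
  assumes "bounded_linear h" "open U"
  shows "Ck_on k U f \<Longrightarrow> Ck_on k U (\<lambda>x. h (f x))"
proof (induction k arbitrary: f)
  case 0
  then show ?case by (auto intro: bounded_linear.continuous_on[OF assms(1)])
next
  case (Suc k)
  show ?case
  proof (rule Ck_on_Suc_intro[OF assms(2)])
    show "((\<lambda>x. h (f x)) has_derivative (\<lambda>v. h (frechet_derivative f (at x) v))) (at x)"
      if "x \<in> U" for x
      using Suc.prems that
      by (intro bounded_linear.has_derivative[OF assms(1)] Ck_on_Suc_has_derivative)
  qed (use Suc in auto)
qed

lemma Ck_on_bounded_bilinear: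
  assumes "bounded_bilinear bop" "open U"
  shows "Ck_on k U f \<Longrightarrow> Ck_on k U g \<Longrightarrow> Ck_on k U (\<lambda>x. bop (f x) (g x))"
proof (induction k arbitrary: f g)
  case 0
  then show ?case by (auto intro: bounded_bilinear.continuous_on[OF assms(1)])
next
  case (Suc k)
  show ?case
  proof (rule Ck_on_Suc_intro[OF assms(2)])
    show "((\<lambda>x. bop (f x) (g x)) has_derivative
        (\<lambda>v. bop (f x) (frechet_derivative g (at x) v) + bop (frechet_derivative f (at x) v) (g x)))
        (at x)" if "x \<in> U" for x
      using Suc.prems that
      by (intro bounded_bilinear.FDERIV[OF assms(1)] Ck_on_Suc_has_derivative)
    show "Ck_on k U (\<lambda>x. bop (f x) (frechet_derivative g (at x) v) +
        bop (frechet_derivative f (at x) v) (g x))" for v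
      using Suc.prems by (intro Ck_on_add[OF assms(2)] Suc.IH) (auto intro: Ck_on_SucD)
  qed
qed

lemma Ck_on_compose_linear:
  assumes "bounded_linear h" "open U" "h ` U \<subseteq> V"
  shows "Ck_on k V f \<Longrightarrow> Ck_on k U (\<lambda>x. f (h x))"
proof (induction k arbitrary: f)
  case 0
  have "continuous_on U (f \<circ> h)"
    by (rule continuous_on_compose)
      (use 0 assms in \<open>auto intro: continuous_on_subset bounded_linear.continuous_on\<close>)
  then show ?case by (simp add: o_def)
next
  case (Suc k)
  show ?case
  proof (rule Ck_on_Suc_intro[OF assms(2)])
    show "((\<lambda>x. f (h x)) has_derivative (\<lambda>v. frechet_derivative f (at (h x)) (h v))) (at x)"
      if "x \<in> U" for x
    proof -
      have "(h has_derivative h) (at x)"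
        by (rule bounded_linear_imp_has_derivative[OF assms(1)])
      moreover have "(f has_derivative frechet_derivative f (at (h x))) (at (h x))"
        using Suc.prems that assms(3) by (intro Ck_on_Suc_has_derivative) auto
      ultimately show ?thesis using diff_chain_at[of h h x] by (fastforce simp: o_def)
    qed
  qed (use Suc in auto)
qed

lemma smooth_on_const: "smooth_on U (\<lambda>x. c)"
  by (simp add: smooth_on_def Ck_on_const)

lemma smooth_on_cong:
  "open U \<Longrightarrow> smooth_on U f \<Longrightarrow> (\<And>x. x \<in> U \<Longrightarrow> f x = g x) \<Longrightarrow> smooth_on U g"
  unfolding smooth_on_def by (blast intro: Ck_on_cong)

lemma smooth_on_add:
  "open U \<Longrightarrow> smooth_on U f \<Longrightarrow> smooth_on U g \<Longrightarrow> smooth_on U (\<lambda>x. f x + g x)"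
  by (simp add: smooth_on_def Ck_on_add)

lemma smooth_on_bounded_linear:
  "bounded_linear h \<Longrightarrow> open U \<Longrightarrow> smooth_on U f \<Longrightarrow> smooth_on U (\<lambda>x. h (f x))"
  by (simp add: smooth_on_def Ck_on_bounded_linear)

lemma smooth_on_bounded_bilinear:
  "bounded_bilinear bop \<Longrightarrow> open U \<Longrightarrow> smooth_on U f \<Longrightarrow> smooth_on U g \<Longrightarrow>
    smooth_on U (\<lambda>x. bop (f x) (g x))"
  by (simp add: smooth_on_def Ck_on_bounded_bilinear)

lemma smooth_on_compose_linear:
  "bounded_linear h \<Longrightarrow> open U \<Longrightarrow> h ` U \<subseteq> V \<Longrightarrow> smooth_on V f \<Longrightarrow> smooth_on U (\<lambda>x. f (h x))"
  by (simp add: smooth_on_def Ck_on_compose_linear)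

lemma smooth_on_linear:
  assumes "bounded_linear h" "open U"
  shows "smooth_on U h"
proof -
  have "Ck_on k U (\<lambda>x. h x)" for k
  proof (cases k)
    case 0
    then show ?thesis by (simp add: bounded_linear.continuous_on[OF assms(1)] continuous_on_id)
  next
    case (Suc j)
    have "Ck_on (Suc j) U h"
      by (rule Ck_on_Suc_intro[OF assms(2) bounded_linear_imp_has_derivative[OF assms(1)] Ck_on_const])
    then show ?thesis by (simp add: Suc)
  qed
  then show ?thesis by (simp add: smooth_on_def)
qed

lemma smooth_on_diff:
  "open U \<Longrightarrow> smooth_on U f \<Longrightarrow> smooth_on U g \<Longrightarrow> smooth_on U (\<lambda>x. f x - g x)"
  using smooth_on_add[of U f "\<lambda>x. - g x"]
    smooth_on_bounded_linear[OF bounded_linear_minus[OF bounded_linear_ident], of U g]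
  by simp

lemma smooth_on_Pair:
  assumes "open U" "smooth_on U f" "smooth_on U g"
  shows "smooth_on U (\<lambda>x. (f x, g x))"
proof -
  have "smooth_on U (\<lambda>x. (f x, 0) + (0, g x))"
    by (intro smooth_on_add assms smooth_on_bounded_linear[where h="\<lambda>x. (x, 0)"]
        smooth_on_bounded_linear[where h="\<lambda>x. (0, x)"])
      (auto intro!: bounded_linear_intros)
  then show ?thesis by simp
qed

lemma smooth_on_has_derivative:
  "smooth_on U f \<Longrightarrow> x \<in> U \<Longrightarrow> (f has_derivative frechet_derivative f (at x)) (at x)"
  by (meson smooth_on_def Ck_on_Suc_has_derivative)

lemma smooth_on_frechet_derivative:
  "smooth_on U f \<Longrightarrow> smooth_on U (\<lambda>x. frechet_derivative f (at x) v)"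
  by (metis smooth_on_def Ck_on.simps(2))

lemma smooth_on_has_vector_derivative:
  assumes "smooth_on U \<gamma>" "t \<in> U"
  shows "(\<gamma> has_vector_derivative velocity \<gamma> t) (at t)"
proof -
  have "\<gamma> differentiable (at t)"
    using smooth_on_has_derivative[OF assms] by (auto simp: differentiable_def)
  then show ?thesis unfolding velocity_def by (simp add: vector_derivative_works)
qed

lemma smooth_on_velocity:
  assumes "open U" "smooth_on U \<gamma>"
  shows "smooth_on U (velocity \<gamma>)"
proof (rule smooth_on_cong[OF assms(1) smooth_on_frechet_derivative[OF assms(2), of 1]])
  fix t assume t: "t \<in> U"
  have "(\<gamma> has_derivative (\<lambda>x. x *\<^sub>R velocity \<gamma> t)) (at t)"
    using smooth_on_has_vector_derivative[OF assms(2) t] by (simp add: has_vector_derivative_def)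
  then show "frechet_derivative \<gamma> (at t) 1 = velocity \<gamma> t"
    by (simp add: frechet_derivative_eqI)
qed

lemma smooth_on_has_real_derivative:
  fixes f :: "real \<Rightarrow> real"
  assumes "smooth_on U f" "t \<in> U"
  shows "(f has_real_derivative deriv f t) (at t)"
proof -
  have "f differentiable (at t)"
    using smooth_on_has_derivative[OF assms] by (auto simp: differentiable_def)
  then show ?thesis
    using DERIV_deriv_iff_real_differentiable by blast
qed

lemma smooth_on_deriv:
  fixes f :: "real \<Rightarrow> real"
  assumes "open U" "smooth_on U f"
  shows "smooth_on U (deriv f)"
proof (rule smooth_on_cong[OF assms(1) smooth_on_velocity[OF assms]])
  fix t assume t: "t \<in> U"
  show "velocity f t = deriv f t"
    using vector_derivative_at smooth_on_has_real_derivative[OF assms(2) t]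
    by (fastforce simp: velocity_def has_real_derivative_iff_has_vector_derivative)
qed

lemma smooth_map_onI:
  "smooth_on UNIV g \<Longrightarrow> (\<And>q. q \<in> M \<Longrightarrow> g q = f q) \<Longrightarrow> smooth_map_on M f"
  unfolding smooth_map_on_def by blast

section \<open>Smooth families of complex numbers from holomorphic functions\<close>

lemma smooth_on_holomorphic:
  assumes "open A" "range of_real \<subseteq> A" "f holomorphic_on A"
  shows "smooth_on UNIV (\<lambda>r::real. f (of_real r))"
proof -
  have "Ck_on k UNIV (\<lambda>r::real. f (of_real r))" for k
    using assms(3)
  proof (induction k arbitrary: f)
    case 0
    have "continuous_on UNIV (f \<circ> of_real)"
      by (intro continuous_on_compose continuous_intros
          continuous_on_subset[OF holomorphic_on_imp_continuous_on[OF 0] assms(2)])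
    then show ?case by (simp add: o_def)
  next
    case (Suc k)
    show ?case
    proof (rule Ck_on_Suc_intro)
      fix x :: real
      have "(f has_field_derivative deriv f (of_real x)) (at (of_real x))"
        using Suc.prems assms holomorphic_derivI by blast
      then show "((\<lambda>r. f (of_real r)) has_derivative (\<lambda>v. of_real v * deriv f (of_real x))) (at x)"
        by (auto simp: has_field_derivative_def mult.commute
          dest!: has_derivative_compose[OF bounded_linear_imp_has_derivative[OF bounded_linear_of_real]])
    next
      fix v :: real
      show "Ck_on k UNIV (\<lambda>x::real. of_real v * deriv f (of_real x))"
        by (rule Suc.IH[where f="\<lambda>z. of_real v * deriv f z"])
          (intro holomorphic_intros holomorphic_deriv Suc.prems assms)
    qed auto
  qed
  then show ?thesis by (simp add: smooth_on_def)
qed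

text \<open>
  For \<open>k = a + \<i> b\<close> the equation says that \<open>r * k r\<close>, which vanishes at \<open>0\<close>, is a primitive of
  \<open>1 / (2 * r + \<i>)\<close>; this forces \<open>k r = Ln (1 - 2 * \<i> * r) / (2 * r)\<close>. On a strip around the
  real line the quotient has only a removable singularity at \<open>0\<close>, so it restricts to a smooth
  function of a real variable.
\<close>

lemma complex_time_profile_exists:
  obtains a b :: "real \<Rightarrow> real"
  where "smooth_on UNIV a" "smooth_on UNIV b"
    "\<And>r. (2 * of_real r + \<i>) *
      (Complex (a r) (b r) + of_real r * Complex (deriv a r) (deriv b r)) = 1"
proof -
  define A where "A = {z. \<bar>Im z\<bar> < 1/2}"
  define F where "F z = Ln (1 - 2 * \<i> * z) / 2" for z
  define K where "K z = (if z = 0 then deriv F 0 else (F z - F 0) / (z - 0))" for z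
  have A: "open A"
  proof -
    have "A = Im -` {-1/2<..<1/2}" by (auto simp: A_def)
    then show ?thesis
      by (auto intro!: open_vimage continuous_intros)
  qed
  have F: "(F has_field_derivative 1 / (2 * z + \<i>)) (at z)" if "z \<in> A" for z
  proof -
    have re: "Re (1 - 2 * \<i> * z) > 0" using that by (simp add: A_def)
    then have "1 - 2 * \<i> * z \<notin> \<real>\<^sub>\<le>\<^sub>0" by (auto simp: complex_nonpos_Reals_iff)
    moreover have "((\<lambda>z. 1 - 2 * \<i> * z) has_field_derivative - 2 * \<i>) (at z)"
      by (auto intro!: derivative_eq_intros)
    ultimately have "(F has_field_derivative inverse (1 - 2 * \<i> * z) * (- 2 * \<i>) / 2) (at z)"
      unfolding F_def by (intro DERIV_cdivide DERIV_chain2[OF has_field_derivative_Ln])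
    moreover have "inverse (1 - 2 * \<i> * z) * (- 2 * \<i>) / 2 = 1 / (2 * z + \<i>)"
    proof -
      have "2 * z + \<i> = \<i> * (1 - 2 * \<i> * z)" by (simp add: algebra_simps)
      then have "1 / (2 * z + \<i>) = inverse (1 - 2 * \<i> * z) * inverse \<i>"
        by (simp only: inverse_eq_divide[symmetric] inverse_mult_distrib mult.commute)
      then show ?thesis by simp
    qed
    ultimately show ?thesis by simp
  qed
  have "F holomorphic_on A"
    using F A by (auto simp: holomorphic_on_open)
  then have K: "K holomorphic_on A"
    unfolding K_def by (rule pole_lemma_open[OF _ A])
  have rA: "of_real r \<in> A" for r by (simp add: A_def)
  have ode: "(2 * of_real r + \<i>) * (K (of_real r) + of_real r * deriv K (of_real r)) = 1" for r
  proof -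
    have "((\<lambda>z. z * K z) has_field_derivative
        K (of_real r) + of_real r * deriv K (of_real r)) (at (of_real r))"
      by (rule derivative_eq_intros holomorphic_derivI[OF K A rA] refl)+ simp
    moreover have "z * K z = F z" for z by (simp add: K_def F_def)
    ultimately have "K (of_real r) + of_real r * deriv K (of_real r) = 1 / (2 * of_real r + \<i>)"
      using DERIV_unique[OF _ F[OF rA]] by simp
    moreover have "2 * of_real r + \<i> \<noteq> 0" by (auto simp: complex_eq_iff)
    ultimately show ?thesis by simp
  qed
  have sK: "smooth_on UNIV (\<lambda>r. K (of_real r))"
    by (rule smooth_on_holomorphic[OF A _ K]) (use rA in auto)
  define a b where "a r = Re (K (of_real r))" and "b r = Im (K (of_real r))" for r
  have dK: "((\<lambda>r. K (of_real r)) has_vector_derivative deriv K (of_real r)) (at r)" for r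
  proof -
    have "(of_real has_vector_derivative 1) (at r)"
      using bounded_linear.has_vector_derivative[OF bounded_linear_of_real has_vector_derivative_id]
      by simp
    from field_vector_diff_chain_at[OF this holomorphic_derivI[OF K A rA[of r]]]
    show ?thesis by (simp add: o_def)
  qed
  have "(a has_real_derivative Re (deriv K (of_real r))) (at r)"
    "(b has_real_derivative Im (deriv K (of_real r))) (at r)" for r
    unfolding a_def b_def has_real_derivative_iff_has_vector_derivative
    by (rule bounded_linear.has_vector_derivative[OF bounded_linear_Re dK]
        bounded_linear.has_vector_derivative[OF bounded_linear_Im dK])+
  then have "deriv a r = Re (deriv K (of_real r))" "deriv b r = Im (deriv K (of_real r))" for r
    by (simp_all add: DERIV_imp_deriv)
  moreover have "smooth_on UNIV a" "smooth_on UNIV b"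
    unfolding a_def b_def using smooth_on_bounded_linear[OF bounded_linear_Re _ sK]
      smooth_on_bounded_linear[OF bounded_linear_Im _ sK] by auto
  ultimately show ?thesis
    using that[of a b] ode by (simp add: a_def b_def)
qed

section \<open>Affine subspaces as manifolds\<close>

definition affine_manifold :: "'a::euclidean_space \<Rightarrow> 'a set \<Rightarrow> 'a set" where
  "affine_manifold p0 S = {p. p - p0 \<in> S}"

lemma affine_manifold_line:
  assumes "subspace S" "p \<in> affine_manifold p0 S" "v \<in> S"
  shows "p + t *\<^sub>R v \<in> affine_manifold p0 S"
proof -
  have "(p - p0) + t *\<^sub>R v \<in> S"
    using assms by (auto simp: affine_manifold_def intro!: subspace_add subspace_scale)
  then show ?thesis by (simp add: affine_manifold_def algebra_simps)
qed

lemma curve_derivative_in_subspace: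
  fixes c :: "real \<Rightarrow> 'a::euclidean_space"
  assumes S: "subspace S" and I: "open I" "t \<in> I" and c: "\<And>s. s \<in> I \<Longrightarrow> c s - p0 \<in> S"
    and v: "(c has_vector_derivative v) (at t)"
  shows "v \<in> S"
proof -
  have "v \<bullet> w = 0" if w: "w \<in> orthogonal_comp S" for w
  proof -
    have "((\<lambda>s. c s \<bullet> w) has_vector_derivative v \<bullet> w) (at t)"
      by (rule bounded_linear.has_vector_derivative[OF bounded_linear_inner_left v])
    moreover have "((\<lambda>s. c s \<bullet> w) has_vector_derivative 0) (at t)"
    proof (rule has_vector_derivative_transform_within_open[OF has_vector_derivative_const I])
      fix s assume "s \<in> I"
      then have "w \<bullet> (c s - p0) = 0"
        using w c by (auto simp: orthogonal_comp_def orthogonal_def inner_commute)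
      then show "p0 \<bullet> w = c s \<bullet> w" by (simp add: inner_commute algebra_simps)
    qed
    ultimately show ?thesis by (rule vector_derivative_unique_at)
  qed
  then have "v \<in> orthogonal_comp (orthogonal_comp S)"
    by (auto simp: orthogonal_comp_def orthogonal_def inner_commute)
  then show ?thesis by (simp add: orthogonal_comp_self S)
qed

lemma tangent_space_affine:
  assumes S: "subspace S" and p: "p \<in> affine_manifold p0 S"
  shows "tangent_space (affine_manifold p0 S) p = S"
proof (intro subset_antisym subsetI)
  fix v assume "v \<in> tangent_space (affine_manifold p0 S) p"
  then obtain c e where c: "e > 0" "c ` {-e<..<e} \<subseteq> affine_manifold p0 S"
    "(c has_vector_derivative v) (at 0)"
    unfolding tangent_space_def by blast
  show "v \<in> S"
    by (rule curve_derivative_in_subspace[OF S, of "{-e<..<e}" 0 c p0])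
      (use c in \<open>simp_all add: affine_manifold_def image_subset_iff\<close>)
next
  fix v assume v: "v \<in> S"
  have "smooth_on {-1<..<1} (\<lambda>t::real. p + t *\<^sub>R v)"
    by (intro smooth_on_add smooth_on_const smooth_on_linear bounded_linear_scaleR_left) simp_all
  moreover have "((\<lambda>t::real. p + t *\<^sub>R v) has_vector_derivative v) (at 0)"
    unfolding has_vector_derivative_def by (auto intro!: derivative_eq_intros)
  moreover have "(\<lambda>t::real. p + t *\<^sub>R v) ` {-1<..<1} \<subseteq> affine_manifold p0 S"
    using affine_manifold_line[OF S p v] by blast
  moreover have "p + 0 *\<^sub>R v = p" "(1::real) > 0" by simp_all
  ultimately show "v \<in> tangent_space (affine_manifold p0 S) p"
    unfolding tangent_space_def mem_Collect_eq by meson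
qed

lemma affine_manifold_Times:
  "affine_manifold (p0, q0) (S \<times> T) = affine_manifold p0 S \<times> affine_manifold q0 T"
  by (auto simp: affine_manifold_def)

lemma tangent_bundle_affine:
  "subspace S \<Longrightarrow>
    tangent_bundle (affine_manifold p0 S) = affine_manifold (p0, 0) (S \<times> S)"
  using tangent_space_affine[of S]
  by (auto simp: affine_manifold_Times tangent_bundle_def affine_manifold_def[of 0])

lemma has_derivative_along_line:
  assumes S: "subspace S" and p: "p \<in> affine_manifold p0 S" and v: "v \<in> S"
    and D: "(f has_derivative D) (at p within affine_manifold p0 S)"
  shows "((\<lambda>t::real. f (p + t *\<^sub>R v)) has_vector_derivative D v) (at 0)"
proof -
  have "((\<lambda>t::real. p + t *\<^sub>R v) has_derivative (\<lambda>t. t *\<^sub>R v)) (at 0)"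
    by (auto intro!: derivative_eq_intros)
  moreover have "(f has_derivative D) (at (p + 0 *\<^sub>R v) within range (\<lambda>t::real. p + t *\<^sub>R v))"
    using D affine_manifold_line[OF S p v] by (auto intro: has_derivative_subset)
  ultimately have "(f \<circ> (\<lambda>t::real. p + t *\<^sub>R v) has_derivative D \<circ> (\<lambda>t. t *\<^sub>R v)) (at 0)"
    by (rule diff_chain_within)
  then show ?thesis
    using linear_simps(5)[OF has_derivative_bounded_linear[OF D]]
    by (simp add: has_vector_derivative_def o_def)
qed

text \<open>
  A derivative within a proper affine subspace is not unique as a linear map on the ambient space,
  but in a direction of the subspace it is an ordinary derivative in one real variable.
\<close>

lemma has_derivative_affine_unique:
  assumes "subspace S" "p \<in> affine_manifold p0 S" "v \<in> S"
    and "(f has_derivative D) (at p within affine_manifold p0 S)"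
    and "(f has_derivative E) (at p within affine_manifold p0 S)"
  shows "D v = E v"
  using assms has_derivative_along_line vector_derivative_unique_at by metis

lemma tangent_deriv_affine:
  assumes "subspace S" "p \<in> affine_manifold p0 S" "v \<in> S"
    and "(f has_derivative D) (at p within affine_manifold p0 S)"
  shows "tangent_deriv (affine_manifold p0 S) f p v = D v"
  unfolding tangent_deriv_def using assms
  by (meson has_derivative_affine_unique frechet_derivative_works differentiable_def)

lemma smooth_map_on_has_derivative:
  assumes "smooth_map_on (M \<inter> U) f" "open U" "p \<in> M \<inter> U"
  obtains D where "(f has_derivative D) (at p within M)"
proof -
  obtain V g where V: "open V" "p \<in> V" "smooth_on V g" "\<forall>q\<in>M \<inter> U \<inter> V. g q = f q"
    using assms(1)[unfolded smooth_map_on_def, THEN bspec, OF assms(3)] by metis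
  have g: "(g has_derivative frechet_derivative g (at p)) (at p within M)"
    by (rule has_derivative_at_withinI[OF smooth_on_has_derivative[OF V(3,2)]])
  obtain d where d: "d > 0" "ball p d \<subseteq> U \<inter> V"
    using open_Int[OF assms(2) V(1)] V(2) assms(3) by (meson IntD2 IntI openE)
  have "(f has_derivative frechet_derivative g (at p)) (at p within M)"
    by (rule has_derivative_transform_within[OF g d(1)])
      (use V(4) d(2) assms(3) in \<open>auto simp: ball_def dist_commute subset_iff\<close>)
  then show thesis by (rule that)
qed

section \<open>Polarizations given by graphs\<close>

text \<open>
  \<open>Lr X\<close> and \<open>Li X\<close> are the real and imaginary part of a complex linear map that depends on
  the fibre coordinate \<open>X = snd q\<close> only. The distribution is the graph of minus this map, from
  vertical to horizontal vectors; expanding \<open>(Lr + \<i> Li) (\<eta>1 + \<i> \<eta>2)\<close> gives the components.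
\<close>

definition graph_distribution ::
    "'a::euclidean_space set \<Rightarrow> ('a \<Rightarrow> 'a \<Rightarrow> 'a) \<Rightarrow> ('a \<Rightarrow> 'a \<Rightarrow> 'a) \<Rightarrow>
      'a \<times> 'a \<Rightarrow> (('a \<times> 'a) \<times> ('a \<times> 'a)) set" where
  "graph_distribution S Lr Li q =
     {((- (Lr (snd q) \<eta>1 - Li (snd q) \<eta>2), \<eta>1), (- (Lr (snd q) \<eta>2 + Li (snd q) \<eta>1), \<eta>2)) |
        \<eta>1 \<eta>2. \<eta>1 \<in> S \<and> \<eta>2 \<in> S}"

lemma graph_distribution_iff:
  "((y1, \<eta>1), (y2, \<eta>2)) \<in> graph_distribution S Lr Li q \<longleftrightarrow>
     \<eta>1 \<in> S \<and> \<eta>2 \<in> S \<and> y1 = - (Lr (snd q) \<eta>1 - Li (snd q) \<eta>2) \<and>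
     y2 = - (Lr (snd q) \<eta>2 + Li (snd q) \<eta>1)"
  by (auto simp: graph_distribution_def)

locale fibre_graph =
  fixes S :: "'a::euclidean_space set" and p0 :: 'a
    and Lr Li :: "'a \<Rightarrow> 'a \<Rightarrow> 'a"
  assumes S: "subspace S"
    and linear_Lr: "\<And>X. linear (Lr X)" and linear_Li: "\<And>X. linear (Li X)"
    and Lr_in: "\<And>X \<eta>. X \<in> S \<Longrightarrow> \<eta> \<in> S \<Longrightarrow> Lr X \<eta> \<in> S"
    and Li_in: "\<And>X \<eta>. X \<in> S \<Longrightarrow> \<eta> \<in> S \<Longrightarrow> Li X \<eta> \<in> S"
    and smooth_Lr: "\<And>\<eta>. smooth_on UNIV (\<lambda>X. Lr X \<eta>)"
    and smooth_Li: "\<And>\<eta>. smooth_on UNIV (\<lambda>X. Li X \<eta>)"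
begin

abbreviation "TM \<equiv> affine_manifold (p0, 0) (S \<times> S)"
abbreviation "P \<equiv> graph_distribution S Lr Li"

text \<open>The vector of the graph over a real vertical vector; these span it over the complex numbers.\<close>

definition frame :: "'a \<Rightarrow> 'a \<times> 'a \<Rightarrow> ('a \<times> 'a) \<times> ('a \<times> 'a)" where
  "frame \<eta> q = ((- Lr (snd q) \<eta>, \<eta>), (- Li (snd q) \<eta>, 0))"

lemma SS: "subspace (S \<times> S)"
  by (simp add: S subspace_Times)

lemma snd_in: "q \<in> TM \<Longrightarrow> snd q \<in> S"
  by (cases q) (auto simp: affine_manifold_def)

lemma subspace_P: "cplx.subspace (P q)"
  unfolding cplx.subspace_def
proof (intro conjI ballI allI)
  show "0 \<in> P q"
    using subspace_0[OF S]
    by (auto simp: zero_prod_def graph_distribution_iff linear_0[OF linear_Lr] linear_0[OF linear_Li])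
next
  fix \<xi> \<zeta> assume "\<xi> \<in> P q" "\<zeta> \<in> P q"
  then obtain a1 a2 b1 b2 where "a1 \<in> S" "a2 \<in> S" "b1 \<in> S" "b2 \<in> S"
    and eq: "\<xi> = ((- (Lr (snd q) a1 - Li (snd q) a2), a1), (- (Lr (snd q) a2 + Li (snd q) a1), a2))"
      "\<zeta> = ((- (Lr (snd q) b1 - Li (snd q) b2), b1), (- (Lr (snd q) b2 + Li (snd q) b1), b2))"
    unfolding graph_distribution_def by auto
  then show "\<xi> + \<zeta> \<in> P q"
    by (simp add: eq graph_distribution_iff subspace_add[OF S] linear_add[OF linear_Lr]
        linear_add[OF linear_Li])
next
  fix c \<xi> assume "\<xi> \<in> P q"
  then obtain a1 a2 where "a1 \<in> S" "a2 \<in> S"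
    and eq: "\<xi> = ((- (Lr (snd q) a1 - Li (snd q) a2), a1), (- (Lr (snd q) a2 + Li (snd q) a1), a2))"
    unfolding graph_distribution_def by auto
  then show "cscale c \<xi> \<in> P q"
    by (simp add: eq cscale_def graph_distribution_iff subspace_add[OF S] subspace_diff[OF S]
        subspace_scale[OF S] linear_add[OF linear_Lr] linear_diff[OF linear_Lr]
        linear_scale[OF linear_Lr] linear_add[OF linear_Li] linear_diff[OF linear_Li]
        linear_scale[OF linear_Li] algebra_simps)
qed

lemma frame_in_P: "\<eta> \<in> S \<Longrightarrow> frame \<eta> q \<in> P q"
  by (simp add: frame_def graph_distribution_iff linear_0[OF linear_Lr] linear_0[OF linear_Li]
      subspace_0[OF S])

lemma inj_frame: "inj_on (\<lambda>\<eta>. frame \<eta> q) A"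
  by (auto simp: inj_on_def frame_def)

lemma sum_frame:
  "(\<Sum>b\<in>B. cscale (c b) (frame b q)) =
     ((- (Lr (snd q) (\<Sum>b\<in>B. Re (c b) *\<^sub>R b) - Li (snd q) (\<Sum>b\<in>B. Im (c b) *\<^sub>R b)),
         \<Sum>b\<in>B. Re (c b) *\<^sub>R b),
      (- (Lr (snd q) (\<Sum>b\<in>B. Im (c b) *\<^sub>R b) + Li (snd q) (\<Sum>b\<in>B. Re (c b) *\<^sub>R b)),
         \<Sum>b\<in>B. Im (c b) *\<^sub>R b))"
  by (induction B rule: infinite_finite_induct)
    (simp_all add: zero_prod_def linear_0[OF linear_Lr] linear_0[OF linear_Li] cscale_def frame_def
      linear_add[OF linear_Lr] linear_scale[OF linear_Lr] linear_add[OF linear_Li]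
      linear_scale[OF linear_Li])

lemma independent_frame:
  assumes "independent B" "finite B"
  shows "cplx.independent ((\<lambda>\<eta>. frame \<eta> q) ` B)"
proof
  assume "cplx.dependent ((\<lambda>\<eta>. frame \<eta> q) ` B)"
  then obtain u where u: "\<exists>v\<in>(\<lambda>\<eta>. frame \<eta> q) ` B. u v \<noteq> 0"
    "(\<Sum>v\<in>(\<lambda>\<eta>. frame \<eta> q) ` B. cscale (u v) v) = 0"
    using assms(2) by (auto simp: cplx.dependent_finite)
  define c where "c b = u (frame b q)" for b
  have "(\<Sum>b\<in>B. cscale (c b) (frame b q)) = 0"
    using u(2) by (simp add: sum.reindex[OF inj_frame] c_def o_def)
  then have "(\<Sum>b\<in>B. Re (c b) *\<^sub>R b) = 0" "(\<Sum>b\<in>B. Im (c b) *\<^sub>R b) = 0"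
    by (simp_all add: sum_frame zero_prod_def)
  then have "\<forall>b\<in>B. Re (c b) = 0" "\<forall>b\<in>B. Im (c b) = 0"
    using independentD[OF assms(1) assms(2) subset_refl, of "\<lambda>b. Re (c b)"]
      independentD[OF assms(1) assms(2) subset_refl, of "\<lambda>b. Im (c b)"] by simp_all
  then show False using u(1) by (auto simp: c_def complex_eq_iff)
qed

lemma span_frame:
  assumes "finite B" "span B = S"
  shows "cplx.span ((\<lambda>\<eta>. frame \<eta> q) ` B) = P q"
proof (rule subset_antisym)
  show "cplx.span ((\<lambda>\<eta>. frame \<eta> q) ` B) \<subseteq> P q"
    by (intro cplx.span_minimal subspace_P image_subsetI frame_in_P)
      (metis assms(2) span_base)
  show "P q \<subseteq> cplx.span ((\<lambda>\<eta>. frame \<eta> q) ` B)"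
  proof
    fix \<xi> assume "\<xi> \<in> P q"
    then obtain \<eta>1 \<eta>2 where \<eta>: "\<eta>1 \<in> S" "\<eta>2 \<in> S"
      and \<xi>: "\<xi> = ((- (Lr (snd q) \<eta>1 - Li (snd q) \<eta>2), \<eta>1),
        (- (Lr (snd q) \<eta>2 + Li (snd q) \<eta>1), \<eta>2))"
      by (auto simp: graph_distribution_def)
    obtain c1 c2 where c: "\<eta>1 = (\<Sum>b\<in>B. c1 b *\<^sub>R b)" "\<eta>2 = (\<Sum>b\<in>B. c2 b *\<^sub>R b)"
      using \<eta> assms span_finite[OF assms(1)] by (metis (no_types, lifting) imageE)
    have "\<xi> = (\<Sum>b\<in>B. cscale (Complex (c1 b) (c2 b)) (frame b q))"
      by (simp add: sum_frame \<xi> c)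
    also have "\<dots> \<in> cplx.span ((\<lambda>\<eta>. frame \<eta> q) ` B)"
      by (intro cplx.span_sum cplx.span_scale cplx.span_base) auto
    finally show "\<xi> \<in> cplx.span ((\<lambda>\<eta>. frame \<eta> q) ` B)" .
  qed
qed

lemma smooth_complex_subbundle_P: "smooth_complex_subbundle TM P"
  unfolding smooth_complex_subbundle_def
proof (intro conjI ballI)
  fix q assume q: "q \<in> TM"
  show "cplx.subspace (P q)" by (rule subspace_P)
  show "P q \<subseteq> complex_tangent_space TM q"
    using snd_in[OF q]
    by (auto simp: complex_tangent_space_def tangent_space_affine[OF SS q] graph_distribution_def
        intro!: subspace_add[OF S] subspace_diff[OF S] subspace_neg[OF S] Lr_in Li_in)
  obtain B where B: "B \<subseteq> S" "independent B" "S \<subseteq> span B"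
    by (metis basis_exists)
  have fin: "finite B" and sp: "span B = S"
    using B S by (simp_all add: independent_imp_finite span_subspace)
  obtain e where e: "bij_betw e {..<card B} B"
    using ex_bij_betw_nat_finite[OF fin] by (auto simp: atLeast0LessThan)
  have img: "(\<lambda>i. frame (e i) q) ` {..<card B} = (\<lambda>\<eta>. frame \<eta> q) ` B" for q
    using e by (force simp: bij_betw_def)
  have sm: "smooth_map_on (TM \<inter> UNIV) (frame \<eta>)" for \<eta>
  proof (rule smooth_map_onI)
    have "smooth_on UNIV (\<lambda>q :: 'a \<times> 'a. F (snd q))" if "smooth_on UNIV F" for F :: "'a \<Rightarrow> 'a"
      by (rule smooth_on_compose_linear[OF bounded_linear_snd _ _ that]) auto
    note sL = this[OF smooth_Lr] this[OF smooth_Li]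
    show "smooth_on UNIV (\<lambda>q. frame \<eta> q)"
      unfolding frame_def
      by (intro smooth_on_Pair smooth_on_const open_UNIV sL
          smooth_on_bounded_linear[OF bounded_linear_minus[OF bounded_linear_ident]])
  qed simp
  have local_frame: "inj_on (\<lambda>i. frame (e i) q) {..<card B} \<and>
      cplx.independent ((\<lambda>i. frame (e i) q) ` {..<card B}) \<and>
      cplx.span ((\<lambda>i. frame (e i) q) ` {..<card B}) = P q" for q
    using e independent_frame[OF B(2) fin, of q] span_frame[OF fin sp, of q]
    unfolding img by (auto simp: inj_on_def bij_betw_def frame_def)
  show "\<exists>U r. \<exists>Z :: nat \<Rightarrow> _. open U \<and> q \<in> U \<and> (\<forall>i<r. smooth_map_on (TM \<inter> U) (Z i)) \<and>
      (\<forall>q\<in>TM \<inter> U. inj_on (\<lambda>i. Z i q) {..<r} \<and> cplx.independent ((\<lambda>i. Z i q) ` {..<r}) \<and>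
        cplx.span ((\<lambda>i. Z i q) ` {..<r}) = P q)"
    by (rule exI[of _ UNIV], rule exI[of _ "card B"], rule exI[of _ "\<lambda>i. frame (e i)"])
      (simp add: local_frame sm[simplified])
qed

lemma dim_P:
  assumes "q \<in> TM"
  shows "2 * cplx.dim (P q) = dim (tangent_space TM q)"
proof -
  obtain B where B: "B \<subseteq> S" "independent B" "S \<subseteq> span B" "card B = dim S"
    by (metis basis_exists)
  have fin: "finite B" and sp: "span B = S"
    using B S by (simp_all add: independent_imp_finite span_subspace)
  have "cplx.dim (P q) = card ((\<lambda>\<eta>. frame \<eta> q) ` B)"
    using span_frame[OF fin sp, of q] independent_frame[OF B(2) fin, of q]
    by (metis cplx.dim_eq_card cplx.span_span)
  also have "\<dots> = dim S" using B(4) by (simp add: card_image[OF inj_frame])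
  finally show ?thesis
    by (simp add: tangent_space_affine[OF SS assms] dim_Times S)
qed

end

section \<open>Involutivity of potential graphs\<close>

lemma linear_expand_Basis:
  fixes x :: "'a::euclidean_space"
  assumes "linear f"
  shows "f x = (\<Sum>b\<in>Basis. (x \<bullet> b) *\<^sub>R f b)"
proof -
  have "f x = f (\<Sum>b\<in>Basis. (x \<bullet> b) *\<^sub>R b)" by (simp add: euclidean_representation)
  also have "\<dots> = (\<Sum>b\<in>Basis. (x \<bullet> b) *\<^sub>R f b)"
    by (simp add: linear_sum[OF assms] linear_scale[OF assms])
  finally show ?thesis .
qed

lemma has_derivative_linear_family:
  fixes L :: "'a::euclidean_space \<Rightarrow> 'b::euclidean_space \<Rightarrow> 'c::real_normed_vector"
  assumes lin: "\<And>X. linear (L X)" and lin': "\<And>X \<zeta>. linear (H X \<zeta>)"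
    and L: "\<And>X \<eta>. ((\<lambda>X. L X \<eta>) has_derivative (\<lambda>\<zeta>. H X \<zeta> \<eta>)) (at X)"
    and \<xi>: "(\<xi> has_derivative X') (at q within T)" and \<eta>: "(\<eta> has_derivative E) (at q within T)"
  shows "((\<lambda>q. L (\<xi> q) (\<eta> q)) has_derivative (\<lambda>v. L (\<xi> q) (E v) + H (\<xi> q) (X' v) (\<eta> q)))
    (at q within T)"
proof -
  have "((\<lambda>q. \<Sum>b\<in>Basis. (\<eta> q \<bullet> b) *\<^sub>R L (\<xi> q) b) has_derivative
      (\<lambda>v. \<Sum>b\<in>Basis. (\<eta> q \<bullet> b) *\<^sub>R H (\<xi> q) (X' v) b + (E v \<bullet> b) *\<^sub>R L (\<xi> q) b))
      (at q within T)"
    by (intro has_derivative_sum has_derivative_scaleR has_derivative_inner_left \<eta>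
        has_derivative_compose[OF \<xi> L])
  then show ?thesis
    by (simp add: linear_expand_Basis[OF lin, symmetric] linear_expand_Basis[OF lin', symmetric]
        sum.distrib add.commute)
qed

text \<open>
  \<open>Hr X \<zeta> \<eta>\<close> and \<open>Hi X \<zeta> \<eta>\<close> are the derivatives of \<open>Lr\<close> and \<open>Li\<close> in direction \<open>\<zeta>\<close>, applied
  to \<open>\<eta>\<close>. Their symmetry says that the vector valued one-form \<open>Lr + \<i> Li\<close> on the fibre is closed,
  as it is for the derivative of a potential, whose second derivative is symmetric. In the bracket
  of two sections of the graph exactly the terms with \<open>Hr\<close> and \<open>Hi\<close> obstruct involutivity, and
  they cancel by symmetry.
\<close>

locale involutive_graph = fibre_graph S p0 Lr Li
  for S :: "'a::euclidean_space set" and p0 Lr Li +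
  fixes Hr Hi :: "'a \<Rightarrow> 'a \<Rightarrow> 'a \<Rightarrow> 'a"
  assumes deriv_Lr: "\<And>X \<eta>. ((\<lambda>X. Lr X \<eta>) has_derivative (\<lambda>\<zeta>. Hr X \<zeta> \<eta>)) (at X)"
    and deriv_Li: "\<And>X \<eta>. ((\<lambda>X. Li X \<eta>) has_derivative (\<lambda>\<zeta>. Hi X \<zeta> \<eta>)) (at X)"
    and sym_Hr: "\<And>X \<zeta> \<eta>. Hr X \<zeta> \<eta> = Hr X \<eta> \<zeta>"
    and sym_Hi: "\<And>X \<zeta> \<eta>. Hi X \<zeta> \<eta> = Hi X \<eta> \<zeta>"
begin

lemma linear_Hr: "linear (Hr X \<zeta>)"
proof -
  have "(\<lambda>\<eta>. Hr X \<eta> \<zeta>) = Hr X \<zeta>" using sym_Hr by blast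
  then show ?thesis using has_derivative_linear[OF deriv_Lr[of \<zeta> X]] by simp
qed

lemma linear_Hi: "linear (Hi X \<zeta>)"
proof -
  have "(\<lambda>\<eta>. Hi X \<eta> \<zeta>) = Hi X \<zeta>" using sym_Hi by blast
  then show ?thesis using has_derivative_linear[OF deriv_Li[of \<zeta> X]] by simp
qed

text \<open>
  A section of the graph is determined by its vertical part, so its derivative in a direction \<open>v\<close>
  is determined by the derivatives \<open>a\<close> and \<open>b\<close> of the real and imaginary vertical part.
\<close>

lemma section_derivative:
  assumes U: "open U" and Z: "smooth_map_on (TM \<inter> U) Z" and ZP: "\<And>q. q \<in> TM \<inter> U \<Longrightarrow> Z q \<in> P q"
    and q: "q \<in> TM \<inter> U" and v: "v \<in> S \<times> S"
  obtains a b where "a \<in> S" "b \<in> S"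
    "tangent_deriv TM (fst \<circ> Z) q v =
      (- (Lr (snd q) a + Hr (snd q) (snd v) (snd (fst (Z q))) - (Li (snd q) b +
        Hi (snd q) (snd v) (snd (snd (Z q))))), a)"
    "tangent_deriv TM (snd \<circ> Z) q v =
      (- (Lr (snd q) b + Hr (snd q) (snd v) (snd (snd (Z q))) + (Li (snd q) a +
        Hi (snd q) (snd v) (snd (fst (Z q))))), b)"
proof -
  have qT: "q \<in> TM" using q by simp
  obtain D where D: "(Z has_derivative D) (at q within TM)"
    using smooth_map_on_has_derivative[OF Z U q] .
  note D1 = has_derivative_fst[OF D] and D2 = has_derivative_snd[OF D]
  note D12 = has_derivative_snd[OF D1] and D22 = has_derivative_snd[OF D2]
  have id: "(snd has_derivative snd) (at q within TM)"
    by (rule bounded_linear_imp_has_derivative[OF bounded_linear_snd])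
  note lr = has_derivative_linear_family[OF linear_Lr linear_Hr deriv_Lr id]
  note li = has_derivative_linear_family[OF linear_Li linear_Hi deriv_Li id]
  obtain d where d: "d > 0" "ball q d \<subseteq> U"
    using U q openE by blast
  have transfer: "(g has_derivative E) (at q within TM)"
    if "(f has_derivative E) (at q within TM)" "\<And>q. q \<in> TM \<inter> U \<Longrightarrow> f q = g q"
    for f g :: "'a \<times> 'a \<Rightarrow> 'a" and E
    by (rule has_derivative_transform_within[OF that(1) d(1) qT])
      (use that(2) d(2) in \<open>auto simp: ball_def dist_commute subset_iff\<close>)
  have y1: "fst (fst (Z q)) = - (Lr (snd q) (snd (fst (Z q))) - Li (snd q) (snd (snd (Z q))))"
    and y2: "fst (snd (Z q)) = - (Lr (snd q) (snd (snd (Z q))) + Li (snd q) (snd (fst (Z q))))"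
    and \<eta>: "snd (fst (Z q)) \<in> S" "snd (snd (Z q)) \<in> S"
    if "q \<in> TM \<inter> U" for q
    using ZP[OF that] by (auto simp: graph_distribution_def)
  have e1: "fst (fst (D v)) = - (Lr (snd q) (snd (fst (D v))) + Hr (snd q) (snd v) (snd (fst (Z q)))
      - (Li (snd q) (snd (snd (D v))) + Hi (snd q) (snd v) (snd (snd (Z q)))))"
    by (rule has_derivative_affine_unique[OF SS qT v has_derivative_fst[OF D1]],
        rule transfer[OF has_derivative_minus[OF has_derivative_diff[OF lr[OF D12] li[OF D22]]]])
      (rule y1[symmetric])
  have e2: "fst (snd (D v)) = - (Lr (snd q) (snd (snd (D v))) + Hr (snd q) (snd v) (snd (snd (Z q)))
      + (Li (snd q) (snd (fst (D v))) + Hi (snd q) (snd v) (snd (fst (Z q)))))"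
    by (rule has_derivative_affine_unique[OF SS qT v has_derivative_fst[OF D2]],
        rule transfer[OF has_derivative_minus[OF has_derivative_add[OF lr[OF D22] li[OF D12]]]])
      (rule y2[symmetric])
  define I where "I = (\<lambda>t::real. q + t *\<^sub>R v) -` U"
  have I: "open I" "0 \<in> I"
    using q unfolding I_def by (auto intro!: open_vimage U continuous_intros)
  have inI: "q + t *\<^sub>R v \<in> TM \<inter> U" if "t \<in> I" for t
    using that affine_manifold_line[OF SS qT v] by (simp add: I_def)
  have "snd (fst (D v)) \<in> S"
    by (rule curve_derivative_in_subspace[OF S I, where ?p0.0=0,
          OF _ has_derivative_along_line[OF SS qT v D12]]) (simp add: \<eta>[OF inI])
  moreover have "snd (snd (D v)) \<in> S"
    by (rule curve_derivative_in_subspace[OF S I, where ?p0.0=0,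
          OF _ has_derivative_along_line[OF SS qT v D22]]) (simp add: \<eta>[OF inI])
  moreover have "tangent_deriv TM (fst \<circ> Z) q v = fst (D v)"
    "tangent_deriv TM (snd \<circ> Z) q v = snd (D v)"
    using tangent_deriv_affine[OF SS qT v D1] tangent_deriv_affine[OF SS qT v D2]
    by (simp_all add: o_def)
  ultimately show thesis
    using that e1 e2 by (metis prod.collapse)
qed

lemma involutive_P: "involutive TM P"
  unfolding involutive_def
proof (intro allI impI ballI, elim conjE)
  fix U Z Z' q
  assume U: "open U" and Z: "smooth_map_on (TM \<inter> U) Z" and Z': "smooth_map_on (TM \<inter> U) Z'"
    and "\<forall>q\<in>TM \<inter> U. Z q \<in> P q \<and> Z' q \<in> P q" and q: "q \<in> TM \<inter> U"
  then have ZP: "\<And>q. q \<in> TM \<inter> U \<Longrightarrow> Z q \<in> P q" and ZP': "\<And>q. q \<in> TM \<inter> U \<Longrightarrow> Z' q \<in> P q"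
    by auto
  obtain \<eta>1 \<eta>2 where Zq: "Z q = ((- (Lr (snd q) \<eta>1 - Li (snd q) \<eta>2), \<eta>1),
      (- (Lr (snd q) \<eta>2 + Li (snd q) \<eta>1), \<eta>2))" and \<eta>: "\<eta>1 \<in> S" "\<eta>2 \<in> S"
    using ZP[OF q] by (auto simp: graph_distribution_def)
  obtain \<eta>1' \<eta>2' where Zq': "Z' q = ((- (Lr (snd q) \<eta>1' - Li (snd q) \<eta>2'), \<eta>1'),
      (- (Lr (snd q) \<eta>2' + Li (snd q) \<eta>1'), \<eta>2'))" and \<eta>': "\<eta>1' \<in> S" "\<eta>2' \<in> S"
    using ZP'[OF q] by (auto simp: graph_distribution_def)
  have X: "snd q \<in> S" using q snd_in by blast
  have tv: "fst (Z q) \<in> S \<times> S" "snd (Z q) \<in> S \<times> S" "fst (Z' q) \<in> S \<times> S" "snd (Z' q) \<in> S \<times> S"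
    using \<eta> \<eta>' X by (auto simp: Zq Zq' intro!: subspace_neg[OF S] subspace_add[OF S]
        subspace_diff[OF S] Lr_in Li_in)
  note der = section_derivative[OF U Z ZP q, unfolded Zq fst_conv snd_conv]
  note der' = section_derivative[OF U Z' ZP' q, unfolded Zq' fst_conv snd_conv]
  obtain a1 a2 where a: "a1 \<in> S" "a2 \<in> S" and
    "tangent_deriv TM (fst \<circ> Z') q (fst (Z q)) =
      (- (Lr (snd q) a1 + Hr (snd q) \<eta>1 \<eta>1' - (Li (snd q) a2 + Hi (snd q) \<eta>1 \<eta>2')), a1)"
    "tangent_deriv TM (snd \<circ> Z') q (fst (Z q)) =
      (- (Lr (snd q) a2 + Hr (snd q) \<eta>1 \<eta>2' + (Li (snd q) a1 + Hi (snd q) \<eta>1 \<eta>1')), a2)"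
    using der'[OF _ tv(1)] by (auto simp: Zq)
  moreover obtain b1 b2 where b: "b1 \<in> S" "b2 \<in> S" and
    "tangent_deriv TM (fst \<circ> Z') q (snd (Z q)) =
      (- (Lr (snd q) b1 + Hr (snd q) \<eta>2 \<eta>1' - (Li (snd q) b2 + Hi (snd q) \<eta>2 \<eta>2')), b1)"
    "tangent_deriv TM (snd \<circ> Z') q (snd (Z q)) =
      (- (Lr (snd q) b2 + Hr (snd q) \<eta>2 \<eta>2' + (Li (snd q) b1 + Hi (snd q) \<eta>2 \<eta>1')), b2)"
    using der'[OF _ tv(2)] by (auto simp: Zq)
  moreover obtain c1 c2 where c: "c1 \<in> S" "c2 \<in> S" and
    "tangent_deriv TM (fst \<circ> Z) q (fst (Z' q)) =
      (- (Lr (snd q) c1 + Hr (snd q) \<eta>1' \<eta>1 - (Li (snd q) c2 + Hi (snd q) \<eta>1' \<eta>2)), c1)"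
    "tangent_deriv TM (snd \<circ> Z) q (fst (Z' q)) =
      (- (Lr (snd q) c2 + Hr (snd q) \<eta>1' \<eta>2 + (Li (snd q) c1 + Hi (snd q) \<eta>1' \<eta>1)), c2)"
    using der[OF _ tv(3)] by (auto simp: Zq')
  moreover obtain d1 d2 where d: "d1 \<in> S" "d2 \<in> S" and
    "tangent_deriv TM (fst \<circ> Z) q (snd (Z' q)) =
      (- (Lr (snd q) d1 + Hr (snd q) \<eta>2' \<eta>1 - (Li (snd q) d2 + Hi (snd q) \<eta>2' \<eta>2)), d1)"
    "tangent_deriv TM (snd \<circ> Z) q (snd (Z' q)) =
      (- (Lr (snd q) d2 + Hr (snd q) \<eta>2' \<eta>2 + (Li (snd q) d1 + Hi (snd q) \<eta>2' \<eta>1)), d2)"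
    using der[OF _ tv(4)] by (auto simp: Zq')
  ultimately have "complex_bracket_at TM Z Z' q =
     ((- (Lr (snd q) ((a1 - c1) - (b2 - d2)) - Li (snd q) ((a2 - c2) + (b1 - d1))),
        (a1 - c1) - (b2 - d2)),
      (- (Lr (snd q) ((a2 - c2) + (b1 - d1)) + Li (snd q) ((a1 - c1) - (b2 - d2))),
        (a2 - c2) + (b1 - d1)))"
    by (simp add: complex_bracket_at_def bracket_at_def linear_add[OF linear_Lr]
        linear_diff[OF linear_Lr] linear_add[OF linear_Li] linear_diff[OF linear_Li]
        sym_Hr[of _ \<eta>1'] sym_Hr[of _ \<eta>2'] sym_Hi[of _ \<eta>1'] sym_Hi[of _ \<eta>2'])
  then show "complex_bracket_at TM Z Z' q \<in> P q"
    using a b c d by (simp add: graph_distribution_iff subspace_add[OF S] subspace_diff[OF S])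
qed

lemma polarization_P: "polarization TM P"
  unfolding polarization_def using smooth_complex_subbundle_P involutive_P dim_P by blast

end

section \<open>The geodesic equation for constant Christoffel symbols\<close>

definition constant_field :: "'a::euclidean_space set \<Rightarrow> 'a \<Rightarrow> 'a \<Rightarrow> 'a" where
  "constant_field M u = (\<lambda>p. if p \<in> M then u else 0)"

lemma constant_field_in_vector_fields:
  assumes "subspace S" "u \<in> S"
  shows "constant_field (affine_manifold p0 S) u \<in> vector_fields (affine_manifold p0 S)"
  using assms
  by (auto simp: vector_fields_def constant_field_def tangent_space_affine
      intro!: smooth_map_onI[OF smooth_on_const[of UNIV u]])

lemma geodesic_velocity_in:
  assumes "subspace S" "geodesic_on (affine_manifold p0 S) nabla I \<gamma>" "t \<in> I"
  shows "velocity \<gamma> t \<in> S"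
proof (rule curve_derivative_in_subspace[OF assms(1)])
  show "open I" "t \<in> I" using assms(2,3) by (auto simp: geodesic_on_def)
  show "\<gamma> s - p0 \<in> S" if "s \<in> I" for s
    using assms(2) that by (auto simp: geodesic_on_def affine_manifold_def)
  show "(\<gamma> has_vector_derivative velocity \<gamma> t) (at t)"
    using assms(2,3) by (auto simp: geodesic_on_def intro: smooth_on_has_vector_derivative)
qed

text \<open>
  Expand the velocity in constant fields \<open>b\<close> from an orthonormal basis of \<open>S\<close>. The Leibniz rule
  gives the coefficient derivatives, and the covariant derivatives of the \<open>b\<close> are the
  Christoffel symbols. The expansion holds on the parameter interval only, whereas \<open>D\<close> acts on
  functions on the whole line, so it is first shown that \<open>D\<close> does not see values outside.
\<close>

lemma geodesic_equation_constant_symbols: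
  fixes nabla :: "'a::euclidean_space connection"
  assumes S: "subspace S"
    and nabla: "\<And>u v. u \<in> S \<Longrightarrow> v \<in> S \<Longrightarrow>
      nabla (constant_field M u) (constant_field M v) = constant_field M (G u v)"
    and G: "\<And>u. linear (G u)"
    and M: "M = affine_manifold p0 S"
    and geo: "geodesic_on M nabla I \<gamma>" and t: "t \<in> I"
  shows "(velocity \<gamma> has_vector_derivative - G (velocity \<gamma> t) (velocity \<gamma> t)) (at t)"
proof -
  have I: "open I" and sm: "smooth_on I \<gamma>" and inM: "\<And>s. s \<in> I \<Longrightarrow> \<gamma> s \<in> M"
    using geo by (auto simp: geodesic_on_def)
  obtain D where cov: "covariant_derivative_along M nabla I \<gamma> D"
    and D0: "D (velocity \<gamma>) t = 0"
    using geo t by (auto simp: geodesic_on_def)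
  have tan: "tangent_space M (\<gamma> s) = S" if "s \<in> I" for s
    using inM[OF that] tangent_space_affine[OF S] by (simp add: M)
  have fields: "V \<in> fields_along M I \<gamma> \<longleftrightarrow> smooth_on I V \<and> (\<forall>s\<in>I. V s \<in> S)" for V
    by (auto simp: fields_along_def tan)
  have D_add: "D (\<lambda>s. V s + V' s) t = D V t + D V' t"
    if "V \<in> fields_along M I \<gamma>" "V' \<in> fields_along M I \<gamma>" for V V'
    using cov that t unfolding covariant_derivative_along_def by blast
  have D_scale: "D (\<lambda>s. f s *\<^sub>R V s) t = deriv f t *\<^sub>R V t + f t *\<^sub>R D V t"
    if "smooth_on I f" "V \<in> fields_along M I \<gamma>" for f V
    using cov that t unfolding covariant_derivative_along_def by blast
  have D_field: "D (\<lambda>s. Y (\<gamma> s)) t = nabla X Y (\<gamma> t)"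
    if "X \<in> vector_fields M" "Y \<in> vector_fields M" "X (\<gamma> t) = velocity \<gamma> t" for X Y
    using cov that t unfolding covariant_derivative_along_def by blast
  \<comment> \<open>The indicator of \<open>I\<close> is smooth on the open set \<open>I\<close>, so the Leibniz rule applies to it.\<close>
  define cut :: "real \<Rightarrow> real" where "cut s = (if s \<in> I then 1 else 0)" for s
  have cut: "smooth_on I cut"
    by (rule smooth_on_cong[OF I smooth_on_const[of I 1]]) (simp add: cut_def)
  have "(cut has_real_derivative 0) (at t)"
    by (rule has_field_derivative_transform_within_open[OF DERIV_const[of 1] I t]) (simp add: cut_def)
  then have dcut: "deriv cut t = 0" by (rule DERIV_imp_deriv)
  have D_local: "D V t = D V' t"
    if "V \<in> fields_along M I \<gamma>" "V' \<in> fields_along M I \<gamma>" "\<And>s. s \<in> I \<Longrightarrow> V s = V' s" for V V'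
  proof -
    have "(\<lambda>s. cut s *\<^sub>R V s) = (\<lambda>s. cut s *\<^sub>R V' s)" using that(3) by (auto simp: cut_def)
    then show ?thesis
      using D_scale[OF cut that(1)] D_scale[OF cut that(2)] dcut t by (simp add: cut_def)
  qed
  have svel: "smooth_on I (velocity \<gamma>)" by (rule smooth_on_velocity[OF I sm])
  have velS: "velocity \<gamma> s \<in> S" if "s \<in> I" for s
    using geodesic_velocity_in[OF S geo[unfolded M] that] .
  have vel: "velocity \<gamma> \<in> fields_along M I \<gamma>" using svel velS by (simp add: fields)
  define w where "w = velocity \<gamma> t"
  define w' where "w' = velocity (velocity \<gamma>) t"
  have w: "w \<in> S" using velS[OF t] by (simp add: w_def)
  have w': "(velocity \<gamma> has_vector_derivative w') (at t)"
    unfolding w'_def by (rule smooth_on_has_vector_derivative[OF svel t])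
  have w'S: "w' \<in> S"
    by (rule curve_derivative_in_subspace[OF S I t _ w', where ?p0.0=0]) (simp add: velS)
  obtain B where B: "B \<subseteq> S" "pairwise orthogonal B" "\<And>x. x \<in> B \<Longrightarrow> norm x = 1"
    "independent B" "span B = S"
    using orthonormal_basis_subspace[OF S] by metis
  have fin: "finite B" using B(4) by (rule independent_imp_finite)
  have expand: "(\<Sum>b\<in>B. (x \<bullet> b) *\<^sub>R b) = x" if "x \<in> S" for x
    using orthonormal_basis_expand[OF B(2,3)] that B(5) fin by blast
  define Y where "Y b s = (velocity \<gamma> s \<bullet> b) *\<^sub>R constant_field M b (\<gamma> s)" for b s
  have cf: "(\<lambda>s. constant_field M b (\<gamma> s)) \<in> fields_along M I \<gamma>" if "b \<in> S" for b
    unfolding fields using that inM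
    by (auto simp: constant_field_def intro!: smooth_on_cong[OF I smooth_on_const[of I b]])
  have coeff: "smooth_on I (\<lambda>s. velocity \<gamma> s \<bullet> b)" for b
    by (rule smooth_on_bounded_linear[OF bounded_linear_inner_left I svel])
  have Y: "Y b \<in> fields_along M I \<gamma>" if "b \<in> S" for b
    using cf[OF that] coeff[of b] unfolding fields Y_def
    by (auto intro!: smooth_on_bounded_bilinear[OF bounded_bilinear_scaleR I] subspace_scale[OF S])
  have DY: "D (Y b) t = (w' \<bullet> b) *\<^sub>R b + (w \<bullet> b) *\<^sub>R G w b" if "b \<in> S" for b
  proof -
    have "((\<lambda>s. velocity \<gamma> s \<bullet> b) has_real_derivative w' \<bullet> b) (at t)"
      using bounded_linear.has_vector_derivative[OF bounded_linear_inner_left w']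
      by (simp add: has_real_derivative_iff_has_vector_derivative)
    then have "deriv (\<lambda>s. velocity \<gamma> s \<bullet> b) t = w' \<bullet> b" by (rule DERIV_imp_deriv)
    moreover have "D (\<lambda>s. constant_field M b (\<gamma> s)) t = G w b"
      using D_field[of "constant_field M w" "constant_field M b"] w that inM[OF t]
        constant_field_in_vector_fields[OF S] nabla[OF w that]
      by (simp add: M constant_field_def w_def)
    ultimately show ?thesis
      unfolding Y_def using D_scale[OF coeff cf[OF that], of b] inM[OF t]
      by (simp add: constant_field_def w_def)
  qed
  have sum: "(\<lambda>s. \<Sum>b\<in>A. Y b s) \<in> fields_along M I \<gamma> \<and>
      D (\<lambda>s. \<Sum>b\<in>A. Y b s) t = (\<Sum>b\<in>A. (w' \<bullet> b) *\<^sub>R b + (w \<bullet> b) *\<^sub>R G w b)"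
    if "finite A" "A \<subseteq> S" for A
    using that
  proof (induction A)
    case empty
    have "D (\<lambda>s. 0 *\<^sub>R velocity \<gamma> s) t = 0"
      using D_scale[OF smooth_on_const vel, of 0] by simp
    then show ?case by (simp add: fields smooth_on_const subspace_0[OF S])
  next
    case (insert b A)
    then show ?case
      using Y[of b] D_add[of "Y b" "\<lambda>s. \<Sum>b\<in>A. Y b s"] DY[of b]
      by (auto simp: fields intro!: smooth_on_add[OF I] subspace_add[OF S])
  qed
  have "D (velocity \<gamma>) t = D (\<lambda>s. \<Sum>b\<in>B. Y b s) t"
    by (rule D_local[OF vel]) (use sum[OF fin B(1)] expand velS inM in \<open>auto simp: Y_def constant_field_def\<close>)
  also have "\<dots> = (\<Sum>b\<in>B. (w' \<bullet> b) *\<^sub>R b + (w \<bullet> b) *\<^sub>R G w b)"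
    using sum[OF fin B(1)] by simp
  also have "\<dots> = w' + G w (\<Sum>b\<in>B. (w \<bullet> b) *\<^sub>R b)"
    by (simp add: sum.distrib expand[OF w'S] linear_sum[OF G] linear_scale[OF G])
  also have "\<dots> = w' + G w w" by (simp add: expand[OF w])
  finally have "w' = - G w w" using D0 by (simp add: eq_neg_iff_add_eq_0)
  then show ?thesis using w' by (simp add: w_def)
qed

section \<open>The complex potential of the geodesic equation\<close>

text \<open>
  The derivative at \<open>X\<close>, in direction \<open>\<eta>\<close>, of the potential \<open>f (lam X) * X + h (lam X) * B X X\<close>,
  for a linear form \<open>lam\<close> and a symmetric bilinear \<open>B\<close>.
\<close>

definition potential_deriv ::
    "('a::euclidean_space \<Rightarrow> real) \<Rightarrow> ('a \<Rightarrow> 'a \<Rightarrow> 'a) \<Rightarrow> (real \<Rightarrow> real) \<Rightarrow> (real \<Rightarrow> real) \<Rightarrow>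
      'a \<Rightarrow> 'a \<Rightarrow> 'a" where
  "potential_deriv lam B f h X \<eta> =
     f (lam X) *\<^sub>R \<eta> + (deriv f (lam X) * lam \<eta>) *\<^sub>R X +
     (deriv h (lam X) * lam \<eta>) *\<^sub>R B X X + (2 * h (lam X)) *\<^sub>R B X \<eta>"

text \<open>The second derivative of the same potential.\<close>

definition potential_hessian ::
    "('a::euclidean_space \<Rightarrow> real) \<Rightarrow> ('a \<Rightarrow> 'a \<Rightarrow> 'a) \<Rightarrow> (real \<Rightarrow> real) \<Rightarrow> (real \<Rightarrow> real) \<Rightarrow>
      'a \<Rightarrow> 'a \<Rightarrow> 'a \<Rightarrow> 'a" where
  "potential_hessian lam B f h X \<zeta> \<eta> =
     deriv f (lam X) *\<^sub>R (lam \<zeta> *\<^sub>R \<eta> + lam \<eta> *\<^sub>R \<zeta>) +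
     (deriv (deriv f) (lam X) * lam \<zeta> * lam \<eta>) *\<^sub>R X +
     (deriv (deriv h) (lam X) * lam \<zeta> * lam \<eta>) *\<^sub>R B X X +
     (2 * deriv h (lam X)) *\<^sub>R (lam \<eta> *\<^sub>R B X \<zeta> + lam \<zeta> *\<^sub>R B X \<eta>) +
     (2 * h (lam X)) *\<^sub>R B \<zeta> \<eta>"

text \<open>
  The geodesic equation to be complexified is \<open>w' = - 2 * lam w * w + B w w\<close> for the velocity
  \<open>w\<close>. The last two conditions say that the values of \<open>B\<close> lie in the kernel of \<open>lam\<close> and in the
  radical of \<open>B\<close>, so that \<open>B\<close> enters all computations below at most linearly.
\<close>

locale quadratic_geodesics =
  fixes S :: "'a::euclidean_space set" and lam :: "'a \<Rightarrow> real" and B :: "'a \<Rightarrow> 'a \<Rightarrow> 'a"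
  assumes subspace_S: "subspace S"
    and lam: "bounded_linear lam" and B: "bounded_bilinear B"
    and B_sym: "\<And>u v. B u v = B v u"
    and B_in: "\<And>u v. u \<in> S \<Longrightarrow> v \<in> S \<Longrightarrow> B u v \<in> S"
    and lam_B: "\<And>u v. lam (B u v) = 0"
    and B_B: "\<And>u v w. B w (B u v) = 0"
begin

lemmas lam_simps = linear_simps[OF lam]
lemmas B_simps = bounded_bilinear.add_left[OF B] bounded_bilinear.add_right[OF B]
  bounded_bilinear.scaleR_left[OF B] bounded_bilinear.scaleR_right[OF B]
  bounded_bilinear.minus_left[OF B] bounded_bilinear.minus_right[OF B]
  bounded_bilinear.diff_left[OF B] bounded_bilinear.diff_right[OF B]

lemma linear_potential_deriv: "linear (potential_deriv lam B f h X)"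
  by (rule linearI) (simp_all add: potential_deriv_def lam_simps B_simps algebra_simps)

lemma potential_deriv_in:
  "X \<in> S \<Longrightarrow> \<eta> \<in> S \<Longrightarrow> potential_deriv lam B f h X \<eta> \<in> S"
  unfolding potential_deriv_def
  by (intro subspace_add[OF subspace_S] subspace_scale[OF subspace_S] B_in)

lemma potential_hessian_sym:
  "potential_hessian lam B f h X \<zeta> \<eta> = potential_hessian lam B f h X \<eta> \<zeta>"
  by (simp add: potential_hessian_def B_sym[of \<zeta> \<eta>] algebra_simps)

lemma has_derivative_potential_deriv:
  assumes f: "smooth_on UNIV f" and h: "smooth_on UNIV h"
  shows "((\<lambda>X. potential_deriv lam B f h X \<eta>) has_derivative
    (\<lambda>\<zeta>. potential_hessian lam B f h X \<zeta> \<eta>)) (at X)"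
proof -
  have comp: "((\<lambda>X. g (lam X)) has_derivative (\<lambda>\<zeta>. deriv g (lam X) * lam \<zeta>)) (at X)"
    if "smooth_on UNIV g" for g :: "real \<Rightarrow> real"
    using has_derivative_compose[OF bounded_linear_imp_has_derivative[OF lam]]
      smooth_on_has_real_derivative[OF that UNIV_I]
    unfolding has_field_derivative_def by blast
  note d = comp[OF f] comp[OF h] comp[OF smooth_on_deriv[OF open_UNIV f]]
    comp[OF smooth_on_deriv[OF open_UNIV h]]
  have BX: "((\<lambda>X. B X \<eta>) has_derivative (\<lambda>\<zeta>. B \<zeta> \<eta>)) (at X)"
    by (rule bounded_linear_imp_has_derivative[OF bounded_bilinear.bounded_linear_left[OF B]])
  have "((\<lambda>X. B X X) has_derivative (\<lambda>\<zeta>. B X \<zeta> + B \<zeta> X)) (at X)"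
    by (rule bounded_bilinear.FDERIV[OF B has_derivative_ident has_derivative_ident])
  moreover have "(\<lambda>\<zeta>. B X \<zeta> + B \<zeta> X) = (\<lambda>\<zeta>. 2 *\<^sub>R B X \<zeta>)"
    unfolding scaleR_2 using B_sym by (intro ext arg_cong2[of _ _ _ _ "(+)"] refl)
  ultimately have BXX: "((\<lambda>X. B X X) has_derivative (\<lambda>\<zeta>. 2 *\<^sub>R B X \<zeta>)) (at X)"
    by simp
  show ?thesis
    unfolding potential_deriv_def
    by (rule has_derivative_eq_rhs[OF has_derivative_add[OF has_derivative_add[OF has_derivative_add[
          OF has_derivative_scaleR[OF d(1) has_derivative_const]
            has_derivative_scaleR[OF has_derivative_mult_left[OF d(3)] has_derivative_ident]]
            has_derivative_scaleR[OF has_derivative_mult_left[OF d(4)] BXX]]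
            has_derivative_scaleR[OF has_derivative_mult_right[OF d(2)] BX]]])
      (simp add: fun_eq_iff potential_hessian_def algebra_simps)
qed

lemma smooth_potential_deriv:
  assumes f: "smooth_on UNIV f" and h: "smooth_on UNIV h"
  shows "smooth_on UNIV (\<lambda>X. potential_deriv lam B f h X \<eta>)"
proof -
  have comp: "smooth_on UNIV (\<lambda>X. g (lam X))" if "smooth_on UNIV g" for g :: "real \<Rightarrow> real"
    by (rule smooth_on_compose_linear[OF lam open_UNIV _ that]) simp
  note d = comp[OF f] comp[OF h] comp[OF smooth_on_deriv[OF open_UNIV f]]
    comp[OF smooth_on_deriv[OF open_UNIV h]]
  note scaleR = smooth_on_bounded_bilinear[OF bounded_bilinear_scaleR open_UNIV]
  note mult = smooth_on_bounded_bilinear[OF bounded_bilinear_mult open_UNIV]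
  have id: "smooth_on UNIV (\<lambda>X::'a. X)" by (rule smooth_on_linear) simp_all
  have BXX: "smooth_on UNIV (\<lambda>X. B X X)"
    by (rule smooth_on_bounded_bilinear[OF B open_UNIV id id])
  have BX: "smooth_on UNIV (\<lambda>X. B X \<eta>)"
    by (rule smooth_on_linear[OF bounded_bilinear.bounded_linear_left[OF B] open_UNIV])
  show ?thesis
    unfolding potential_deriv_def
    by (rule smooth_on_add[OF open_UNIV] scaleR mult d smooth_on_const id BXX BX)+
qed

text \<open>
  For \<open>k = a + \<i> b\<close>, \<open>Lr\<close> and \<open>Li\<close> are the real and imaginary part of the derivative of the
  complex potential \<open>k (lam X) * X + (k (lam X))\<^sup>2 / 2 * B X X\<close>. Along a geodesic with velocity
  \<open>w\<close>, the map from \<open>t + \<i> s\<close> to \<open>s w\<close> sends the (1,0)-vector to one with horizontal part \<open>w\<close>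
  and vertical part \<open>s w' - \<i> w\<close>. The graph contains it if \<open>Lr + \<i> Li\<close> sends \<open>s w' - \<i> w\<close> to
  \<open>- w\<close>. Modulo \<open>B\<close> this is the equation for \<open>k\<close> at \<open>r = lam X\<close>; the coefficient \<open>k\<^sup>2 / 2\<close> is
  the one for which the terms with \<open>B\<close> cancel by the same equation.
\<close>

lemma potential_deriv_geodesic:
  fixes a b :: "real \<Rightarrow> real"
  assumes ode: "\<And>r. (2 * of_real r + \<i>) *
      (Complex (a r) (b r) + of_real r * Complex (deriv a r) (deriv b r)) = 1"
    and a: "smooth_on UNIV a" and b: "smooth_on UNIV b"
    and X: "X = s *\<^sub>R w" and \<eta>: "\<eta> = s *\<^sub>R (- (2 * lam w) *\<^sub>R w + B w w)"
  defines "Lr \<equiv> potential_deriv lam B a (\<lambda>r. ((a r)\<^sup>2 - (b r)\<^sup>2) / 2)"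
    and "Li \<equiv> potential_deriv lam B b (\<lambda>r. a r * b r)"
  shows "- (Lr X \<eta> - Li X (- w)) = w" "- (Lr X (- w) + Li X \<eta>) = 0"
proof -
  define r where "r = lam X"
  have da: "(a has_real_derivative deriv a r) (at r)" and db: "(b has_real_derivative deriv b r) (at r)"
    using smooth_on_has_real_derivative[OF a] smooth_on_has_real_derivative[OF b] by auto
  have dh1: "deriv (\<lambda>r. ((a r)\<^sup>2 - (b r)\<^sup>2) / 2) r = a r * deriv a r - b r * deriv b r"
    by (rule DERIV_imp_deriv) (auto intro!: derivative_eq_intros da db simp: field_simps)
  have dh2: "deriv (\<lambda>r. a r * b r) r = deriv a r * b r + a r * deriv b r"
    by (rule DERIV_imp_deriv) (auto intro!: derivative_eq_intros da db simp: field_simps)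
  \<comment> \<open>Real and imaginary part of the derivative of \<open>r * k r\<close>.\<close>
  define \<alpha> where "\<alpha> = a r + r * deriv a r"
  define \<beta> where "\<beta> = b r + r * deriv b r"
  have "(2 * of_real r + \<i>) * Complex \<alpha> \<beta> = 1"
    using ode[of r] by (simp add: \<alpha>_def \<beta>_def complex_eq_iff)
  then have re: "2 * r * \<alpha> - \<beta> = 1" and im: "2 * r * \<beta> + \<alpha> = 0"
    by (simp_all add: complex_eq_iff)
  have \<eta>': "\<eta> = - (2 * r) *\<^sub>R w + B X w"
    by (simp add: \<eta> r_def X lam_simps B_simps algebra_simps)
  have lam\<eta>: "lam \<eta> = - (2 * r) * lam w" "B X \<eta> = - (2 * r) *\<^sub>R B X w"
    by (simp_all add: \<eta>' lam_simps B_simps lam_B B_B)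
  have wX: "lam w *\<^sub>R X = r *\<^sub>R w" "lam w *\<^sub>R B X X = r *\<^sub>R B X w"
    by (simp_all add: X r_def lam_simps B_simps mult_ac)
  have pot: "potential_deriv lam B f h X \<eta> =
      (- 2 * r * (f r + r * deriv f r)) *\<^sub>R w +
      (f r - 2 * r * (r * deriv h r + 2 * h r)) *\<^sub>R B X w"
    "potential_deriv lam B f h X (- w) =
      (- (f r + r * deriv f r)) *\<^sub>R w + (- (r * deriv h r + 2 * h r)) *\<^sub>R B X w" for f h
  proof -
    have sc: "(c * lam w) *\<^sub>R X = (c * r) *\<^sub>R w" "(c * lam w) *\<^sub>R B X X = (c * r) *\<^sub>R B X w" for c
      using wX by (metis scaleR_scaleR)+
    have "potential_deriv lam B f h X \<eta> = f r *\<^sub>R \<eta> +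
        ((deriv f r * - (2 * r)) * lam w) *\<^sub>R X + ((deriv h r * - (2 * r)) * lam w) *\<^sub>R B X X +
        (2 * h r) *\<^sub>R B X \<eta>"
      by (simp add: potential_deriv_def lam\<eta>(1) r_def[symmetric] mult_ac)
    then show "potential_deriv lam B f h X \<eta> =
      (- 2 * r * (f r + r * deriv f r)) *\<^sub>R w +
      (f r - 2 * r * (r * deriv h r + 2 * h r)) *\<^sub>R B X w"
      unfolding sc lam\<eta>(2) by (simp add: \<eta>' algebra_simps)
    have "potential_deriv lam B f h X (- w) = f r *\<^sub>R (- w) +
        (- deriv f r * lam w) *\<^sub>R X + (- deriv h r * lam w) *\<^sub>R B X X + (2 * h r) *\<^sub>R B X (- w)"
      by (simp add: potential_deriv_def lam_simps r_def[symmetric])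
    then show "potential_deriv lam B f h X (- w) =
      (- (f r + r * deriv f r)) *\<^sub>R w + (- (r * deriv h r + 2 * h r)) *\<^sub>R B X w"
      unfolding sc by (simp add: B_simps algebra_simps)
  qed
  have h1: "r * deriv (\<lambda>r. ((a r)\<^sup>2 - (b r)\<^sup>2) / 2) r + 2 * (((a r)\<^sup>2 - (b r)\<^sup>2) / 2) = a r * \<alpha> - b r * \<beta>"
    unfolding dh1 \<alpha>_def \<beta>_def by (simp add: power2_eq_square field_simps)
  have h2: "r * deriv (\<lambda>r. a r * b r) r + 2 * (a r * b r) = b r * \<alpha> + a r * \<beta>"
    unfolding dh2 \<alpha>_def \<beta>_def by (simp add: algebra_simps)
  have "- (Lr X \<eta> - Li X (- w)) = (2 * r * \<alpha> - \<beta>) *\<^sub>R w -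
      (a r - 2 * r * (a r * \<alpha> - b r * \<beta>) + (b r * \<alpha> + a r * \<beta>)) *\<^sub>R B X w"
    unfolding Lr_def Li_def pot h1 h2 \<alpha>_def[symmetric] \<beta>_def[symmetric] by (simp add: algebra_simps)
  moreover have "a r - 2 * r * (a r * \<alpha> - b r * \<beta>) + (b r * \<alpha> + a r * \<beta>) =
      a r * (1 - (2 * r * \<alpha> - \<beta>)) + b r * (2 * r * \<beta> + \<alpha>)" by (simp add: algebra_simps)
  ultimately show "- (Lr X \<eta> - Li X (- w)) = w" by (simp add: re im)
  have "- (Lr X (- w) + Li X \<eta>) = (2 * r * \<beta> + \<alpha>) *\<^sub>R w -
      (b r - 2 * r * (b r * \<alpha> + a r * \<beta>) - (a r * \<alpha> - b r * \<beta>)) *\<^sub>R B X w"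
    unfolding Lr_def Li_def pot h1 h2 \<alpha>_def[symmetric] \<beta>_def[symmetric] by (simp add: algebra_simps)
  moreover have "b r - 2 * r * (b r * \<alpha> + a r * \<beta>) - (a r * \<alpha> - b r * \<beta>) =
      b r * (1 - (2 * r * \<alpha> - \<beta>)) - a r * (2 * r * \<beta> + \<alpha>)" by (simp add: algebra_simps)
  ultimately show "- (Lr X (- w) + Li X \<eta>) = 0" by (simp add: re im)
qed

lemma P_complete_affine:
  assumes geo: "\<And>I \<gamma> t. geodesic_on (affine_manifold p0 S) nabla I \<gamma> \<Longrightarrow> t \<in> I \<Longrightarrow>
    (velocity \<gamma> has_vector_derivative
      - (2 * lam (velocity \<gamma> t)) *\<^sub>R velocity \<gamma> t + B (velocity \<gamma> t) (velocity \<gamma> t)) (at t)"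
  shows "P_complete (affine_manifold p0 S) nabla"
proof -
  obtain a b :: "real \<Rightarrow> real" where a: "smooth_on UNIV a" and b: "smooth_on UNIV b"
    and ode: "\<And>r. (2 * of_real r + \<i>) *
      (Complex (a r) (b r) + of_real r * Complex (deriv a r) (deriv b r)) = 1"
    using complex_time_profile_exists by blast
  note mult = smooth_on_bounded_bilinear[OF bounded_bilinear_mult open_UNIV]
  have h1: "smooth_on UNIV (\<lambda>r. ((a r)\<^sup>2 - (b r)\<^sup>2) / 2)"
    using smooth_on_bounded_linear[OF bounded_linear_divide[of 2] open_UNIV
        smooth_on_diff[OF open_UNIV mult[OF a a] mult[OF b b]]]
    by (simp add: power2_eq_square)
  have h2: "smooth_on UNIV (\<lambda>r. a r * b r)" by (rule mult[OF a b])
  define Lr where "Lr = potential_deriv lam B a (\<lambda>r. ((a r)\<^sup>2 - (b r)\<^sup>2) / 2)"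
  define Li where "Li = potential_deriv lam B b (\<lambda>r. a r * b r)"
  interpret involutive_graph S p0 Lr Li
    "potential_hessian lam B a (\<lambda>r. ((a r)\<^sup>2 - (b r)\<^sup>2) / 2)"
    "potential_hessian lam B b (\<lambda>r. a r * b r)"
    unfolding Lr_def Li_def
    by (intro involutive_graph.intro fibre_graph.intro involutive_graph_axioms.intro;
        rule subspace_S linear_potential_deriv potential_deriv_in
          smooth_potential_deriv[OF a h1] smooth_potential_deriv[OF b h2]
          has_derivative_potential_deriv[OF a h1] has_derivative_potential_deriv[OF b h2]
          potential_hessian_sym; assumption)
  have ac: "map_prod (frechet_derivative (Omega_map \<gamma>) (at z)) (frechet_derivative (Omega_map \<gamma>) (at z))
      ` T10 \<subseteq> P (Omega_map \<gamma> z)"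
    if "maximal_geodesic (affine_manifold p0 S) nabla v I \<gamma>" and "z \<in> complexified_interval I"
    for v I \<gamma> z
  proof -
    have geod: "geodesic_on (affine_manifold p0 S) nabla I \<gamma>" and z: "Re z \<in> I"
      using that by (simp_all add: maximal_geodesic_def complexified_interval_def)
    define w where "w = velocity \<gamma> (Re z)"
    define w' where "w' = - (2 * lam w) *\<^sub>R w + B w w"
    have w: "(\<gamma> has_vector_derivative w) (at (Re z))"
      using geod z unfolding w_def geodesic_on_def by (blast intro: smooth_on_has_vector_derivative)
    have w': "(velocity \<gamma> has_vector_derivative w') (at (Re z))"
      using geo[OF geod z] by (simp add: w'_def w_def)
    have wS: "w \<in> S" unfolding w_def by (rule geodesic_velocity_in[OF subspace_S geod z])
    have w'S: "w' \<in> S"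
      unfolding w'_def by (intro subspace_add[OF subspace_S] subspace_scale[OF subspace_S] B_in wS)
    have re: "(Re has_derivative Re) (at z)" and im: "(Im has_derivative Im) (at z)"
      by (rule bounded_linear_imp_has_derivative[OF bounded_linear_Re]
          bounded_linear_imp_has_derivative[OF bounded_linear_Im])+
    have "((\<lambda>z. \<gamma> (Re z)) has_derivative (\<lambda>\<delta>. Re \<delta> *\<^sub>R w)) (at z)"
      "((\<lambda>z. velocity \<gamma> (Re z)) has_derivative (\<lambda>\<delta>. Re \<delta> *\<^sub>R w')) (at z)"
      using has_derivative_compose[OF re w[unfolded has_vector_derivative_def]]
        has_derivative_compose[OF re w'[unfolded has_vector_derivative_def]] by simp_all
    then have "(Omega_map \<gamma> has_derivative
        (\<lambda>\<delta>. (Re \<delta> *\<^sub>R w, Im z *\<^sub>R (Re \<delta> *\<^sub>R w') + Im \<delta> *\<^sub>R w))) (at z)"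
      unfolding Omega_map_def w_def by (intro has_derivative_Pair has_derivative_scaleR im)
    then have d: "frechet_derivative (Omega_map \<gamma>) (at z) =
        (\<lambda>\<delta>. (Re \<delta> *\<^sub>R w, Im z *\<^sub>R (Re \<delta> *\<^sub>R w') + Im \<delta> *\<^sub>R w))"
      by (rule frechet_derivative_eqI)
    \<comment> \<open>The image of the (1,0)-vector \<open>d/dt - \<i> d/ds\<close>, where \<open>z = t + \<i> s\<close>.\<close>
    have base: "((w, Im z *\<^sub>R w'), (0, - w)) \<in> P (Omega_map \<gamma> z)"
      using potential_deriv_geodesic[OF ode a b refl refl, of "Im z" w, folded w'_def Lr_def Li_def]
        wS w'S
      by (simp add: graph_distribution_iff Omega_map_def w_def[symmetric]
          subspace_scale[OF subspace_S] subspace_neg[OF subspace_S])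
    show ?thesis
    proof (rule image_subsetI)
      fix \<xi> :: "complex \<times> complex" assume \<xi>: "\<xi> \<in> T10"
      have "snd \<xi> = - (\<i> * fst \<xi>)" using \<xi> by (cases \<xi>) (auto simp: T10_def cscale_def)
      then have "map_prod (frechet_derivative (Omega_map \<gamma>) (at z))
          (frechet_derivative (Omega_map \<gamma>) (at z)) \<xi> = cscale (fst \<xi>) ((w, Im z *\<^sub>R w'), (0, - w))"
        by (cases \<xi>) (simp add: d cscale_def algebra_simps)
      then show "map_prod (frechet_derivative (Omega_map \<gamma>) (at z))
          (frechet_derivative (Omega_map \<gamma>) (at z)) \<xi> \<in> P (Omega_map \<gamma> z)"
        using cplx.subspace_scale[OF subspace_P base] by metis
    qed

  qed
  have "ac_polarization (affine_manifold p0 S) nabla P"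
    unfolding ac_polarization_def tangent_bundle_affine[OF subspace_S] Let_def
    by (intro conjI ballI allI impI polarization_P ac)
  then show ?thesis unfolding P_complete_def by blast
qed

end

section \<open>The Heisenberg algebra\<close>

abbreviation center_vec :: "'n::finite hmat" where
  "center_vec \<equiv> unit_mat First Last"

definition heis_lin :: "'n::finite hmat set" where
  "heis_lin = {x. (\<forall>i. x $ i $ First = 0) \<and> (\<forall>j. x $ Last $ j = 0) \<and>
     (\<forall>k l. x $ Mid k $ Mid l = 0)}"

text \<open>
  Composition with this projection turns maps that are linear on the Lie algebra only into linear
  maps on the space of all matrices.
\<close>

definition heis_proj :: "'n::finite hmat \<Rightarrow> 'n hmat" where
  "heis_proj x = (\<chi> i j. if i = First \<and> j \<noteq> First \<or> j = Last \<and> i \<noteq> Last then x $ i $ j else 0)"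

text \<open>The coefficient of the centre in the matrix product of two elements of the Lie algebra.\<close>

definition heis_dot :: "'n::finite hmat \<Rightarrow> 'n hmat \<Rightarrow> real" where
  "heis_dot x y = (\<Sum>k\<in>UNIV. x $ First $ Mid k * y $ Mid k $ Last)"

lemma sum_hidx: "(\<Sum>i\<in>UNIV. f i) = f First + (\<Sum>k\<in>UNIV. f (Mid k)) + f Last"
  for f :: "'n::finite hidx \<Rightarrow> real"
proof -
  have U: "(UNIV :: 'n hidx set) = insert First (insert Last (range Mid))"
    by (auto intro: hidx.exhaust)
  have "(\<Sum>i\<in>range Mid. f i) = (\<Sum>k\<in>UNIV. f (Mid k))"
    by (subst sum.reindex) (auto simp: inj_on_def)
  then show ?thesis unfolding U by (subst sum.insert; (subst sum.insert)?; auto)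
qed

lemma hmat_eq_iff:
  "(x :: 'n::finite hmat) = y \<longleftrightarrow> (\<forall>i j. x $ i $ j = y $ i $ j)"
  by (simp add: vec_eq_iff)

lemma heis_lin_eq_iff:
  assumes "x \<in> heis_lin" "y \<in> heis_lin"
  shows "x = y \<longleftrightarrow> (\<forall>k. x $ First $ Mid k = y $ First $ Mid k) \<and>
    (\<forall>k. x $ Mid k $ Last = y $ Mid k $ Last) \<and> x $ First $ Last = y $ First $ Last"
proof -
  have "x $ i $ j = y $ i $ j" if "\<forall>k. x $ First $ Mid k = y $ First $ Mid k"
    "\<forall>k. x $ Mid k $ Last = y $ Mid k $ Last" "x $ First $ Last = y $ First $ Last" for i j
    using that assms by (cases i; cases j) (auto simp: heis_lin_def)
  then show ?thesis by (auto simp: hmat_eq_iff)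
qed

lemma subspace_heis_lin: "subspace heis_lin"
  by (auto simp: subspace_def heis_lin_def)

lemmas heis_lin_closed = subspace_add[OF subspace_heis_lin] subspace_diff[OF subspace_heis_lin]
  subspace_scale[OF subspace_heis_lin] subspace_neg[OF subspace_heis_lin]
  subspace_0[OF subspace_heis_lin]

lemma center_in: "center_vec \<in> heis_lin"
  by (auto simp: heis_lin_def unit_mat_def)

lemma center_entry [simp]: "center_vec $ First $ Last = 1"
  by (simp add: unit_mat_def)

lemma center_nonzero [simp]: "center_vec \<noteq> 0"
  by (metis center_entry zero_index zero_neq_one)

lemma unit_mat_in: "unit_mat First (Mid k) \<in> heis_lin" "unit_mat (Mid k) Last \<in> heis_lin"
  by (auto simp: heis_lin_def unit_mat_def)

lemma heis_proj_in: "heis_proj x \<in> heis_lin"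
  by (auto simp: heis_lin_def heis_proj_def)

lemma heis_proj_ident: "x \<in> heis_lin \<Longrightarrow> heis_proj x = x"
  using heis_proj_in by (subst heis_lin_eq_iff) (auto simp: heis_proj_def)

lemma linear_heis_proj: "linear heis_proj"
  by (rule linearI) (auto simp: heis_proj_def vec_eq_iff)

lemma heis_affine: "(heis :: 'n::finite hmat set) = affine_manifold (mat 1) heis_lin"
proof (intro subset_antisym subsetI)
  fix g :: "'n hmat" assume "g \<in> heis"
  then show "g \<in> affine_manifold (mat 1) heis_lin"
    by (auto simp: heis_def affine_manifold_def heis_lin_def heis_mat_def mat_def split: hidx.splits)
next
  fix g :: "'n hmat" assume "g \<in> affine_manifold (mat 1) heis_lin"
  then have g: "g $ i $ First = (if i = First then 1 else 0)"
    "g $ Last $ j = (if j = Last then 1 else 0)"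
    "g $ Mid k $ Mid l = (if k = l then 1 else 0)" for i j k l
    by (auto simp: affine_manifold_def heis_lin_def mat_def)
  have "g $ i $ j =
      heis_mat (\<chi> k. g $ First $ Mid k) (\<chi> k. g $ Mid k $ Last) (g $ First $ Last) $ i $ j" for i j
    by (cases i; cases j) (simp_all add: heis_mat_def g)
  then have "g = heis_mat (\<chi> k. g $ First $ Mid k) (\<chi> k. g $ Mid k $ Last) (g $ First $ Last)"
    unfolding hmat_eq_iff by blast
  then show "g \<in> heis" unfolding heis_def by blast
qed

lemma heis_iff: "g \<in> heis \<longleftrightarrow> g - mat 1 \<in> heis_lin"
  by (simp add: heis_affine affine_manifold_def)

lemma one_in_heis: "mat 1 \<in> heis"
  by (simp add: heis_iff heis_lin_closed)

lemma heis_cases: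
  assumes "g \<in> heis"
  obtains z where "z \<in> heis_lin" "g = mat 1 + z"
  using assms by (metis heis_iff add_diff_cancel_left' diff_add_cancel add.commute)

lemma tangent_space_heis: "g \<in> heis \<Longrightarrow> tangent_space heis g = heis_lin"
  unfolding heis_affine by (rule tangent_space_affine[OF subspace_heis_lin])

lemma heis_alg_eq: "heis_alg = heis_lin"
  unfolding heis_alg_def by (rule tangent_space_heis[OF one_in_heis])

lemma heis_mult:
  assumes "x \<in> heis_lin" "y \<in> heis_lin"
  shows "x ** y = heis_dot x y *\<^sub>R center_vec"
proof -
  have "(x ** y) $ i $ j = (heis_dot x y *\<^sub>R center_vec) $ i $ j" for i j
    using assms by (cases i; cases j)
      (auto simp: matrix_matrix_mult_def heis_lin_def heis_dot_def unit_mat_def sum_hidx)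
  then show ?thesis by (simp add: hmat_eq_iff)
qed

lemma bilinear_heis_dot: "bilinear heis_dot"
  by (auto simp: bilinear_def heis_dot_def linear_iff sum.distrib algebra_simps sum_distrib_left)

lemmas heis_dot_simps = bilinear_ladd[OF bilinear_heis_dot] bilinear_radd[OF bilinear_heis_dot]
  bilinear_lmul[OF bilinear_heis_dot] bilinear_rmul[OF bilinear_heis_dot]
  bilinear_lneg[OF bilinear_heis_dot] bilinear_rneg[OF bilinear_heis_dot]
  bilinear_lsub[OF bilinear_heis_dot] bilinear_rsub[OF bilinear_heis_dot]

lemma heis_dot_center [simp]: "heis_dot x center_vec = 0" "heis_dot center_vec x = 0"
  by (simp_all add: heis_dot_def unit_mat_def)

lemma heis_dot_unit [simp]:
  "heis_dot (unit_mat First (Mid k)) u = u $ Mid k $ Last"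
  "heis_dot u (unit_mat (Mid k) Last) = u $ First $ Mid k"
  "heis_dot (unit_mat (Mid k) Last) u = 0" "heis_dot u (unit_mat First (Mid k)) = 0"
  by (simp_all add: heis_dot_def unit_mat_def mult_delta_left mult_delta_right)

lemma heis_dot_proj: "heis_dot (heis_proj x) (heis_proj y) = heis_dot x y"
  by (simp add: heis_dot_def heis_proj_def)

text \<open>
  The bracket is a nondegenerate pairing on \<open>W\<close>: each entry of \<open>u\<close> other than the central one is,
  up to sign, its bracket with a basis vector of \<open>W\<close>.
\<close>

lemma heis_central:
  assumes u: "u \<in> heis_lin" and c: "\<And>z. z \<in> heis_lin \<Longrightarrow> heis_dot u z - heis_dot z u = 0"
  shows "u = (u $ First $ Last) *\<^sub>R center_vec"
proof -
  have "u $ First $ Mid k = 0" "u $ Mid k $ Last = 0" for k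
    using c[OF unit_mat_in(1)[of k]] c[OF unit_mat_in(2)[of k]]
    by simp_all
  then show ?thesis
    by (subst heis_lin_eq_iff[OF u heis_lin_closed(3)[OF center_in]]) (simp add: unit_mat_def)
qed

lemma mat_bracket_heis:
  "x \<in> heis_lin \<Longrightarrow> y \<in> heis_lin \<Longrightarrow>
    mat_bracket x y = (heis_dot x y - heis_dot y x) *\<^sub>R center_vec"
  by (simp add: mat_bracket_def heis_mult algebra_simps)

lemma matrix_add_rdistrib: "(A + B) ** C = A ** C + B ** C"
  for A B :: "real ^ 'm::finite ^ 'n::finite" and C :: "real ^ 'k::finite ^ 'm"
  by (simp add: matrix_matrix_mult_def vec_eq_iff sum.distrib distrib_right)

lemma heis_group_mult:
  "(mat 1 + z) ** (mat 1 + w) = mat 1 + (z + w + z ** w)" for z w :: "'n::finite hmat"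
  by (simp add: matrix_add_ldistrib matrix_add_rdistrib algebra_simps)

lemma heis_action:
  "z \<in> heis_lin \<Longrightarrow> x \<in> heis_lin \<Longrightarrow> (mat 1 + z) ** x = x + heis_dot z x *\<^sub>R center_vec"
  by (simp add: matrix_add_rdistrib heis_mult)

lemma heis_mult_closed:
  assumes "g \<in> heis" "h \<in> heis"
  shows "g ** h \<in> heis"
proof -
  obtain z w where zw: "z \<in> heis_lin" "g = mat 1 + z" "w \<in> heis_lin" "h = mat 1 + w"
    using assms heis_cases by metis
  then show ?thesis by (simp add: heis_iff heis_group_mult heis_mult heis_lin_closed center_in)
qed

lemma heis_inverse:
  assumes "g \<in> heis"
  obtains g' where "g' \<in> heis" "g ** g' = mat 1" "g' ** g = mat 1"
proof -
  obtain z where z: "z \<in> heis_lin" "g = mat 1 + z" using assms heis_cases by metis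
  define w where "w = heis_dot z z *\<^sub>R center_vec - z"
  have w: "w \<in> heis_lin" unfolding w_def by (intro heis_lin_closed center_in z)
  have "mat 1 + w \<in> heis" using w by (simp add: heis_iff)
  moreover have "g ** (mat 1 + w) = mat 1" "(mat 1 + w) ** g = mat 1"
    unfolding z(2) heis_group_mult heis_mult[OF z(1) w] heis_mult[OF w z(1)]
    by (simp_all add: w_def heis_dot_simps)
  ultimately show thesis using that by blast
qed

lemma linear_mult_left: "linear (\<lambda>h::'n::finite hmat. g ** h)"
  by (rule linearI) (simp_all add: matrix_add_ldistrib matrix_scalar_ac scalar_matrix_assoc[symmetric])

lemma linear_mult_right: "linear (\<lambda>h::'n::finite hmat. h ** g)"
  by (rule linearI) (simp_all add: matrix_add_rdistrib scalar_matrix_assoc[symmetric])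

lemma left_invariant_field_at_one: "left_invariant_field x (mat 1) = x"
  by (simp add: left_invariant_field_def one_in_heis)

lemma left_invariant_field_eq:
  "z \<in> heis_lin \<Longrightarrow> x \<in> heis_lin \<Longrightarrow>
    left_invariant_field x (mat 1 + z) = x + heis_dot z x *\<^sub>R center_vec"
  by (simp add: left_invariant_field_def heis_iff heis_action)

lemma left_invariant_field_add:
  "left_invariant_field (x + y) = (\<lambda>p. left_invariant_field x p + left_invariant_field y p)"
  by (auto simp: left_invariant_field_def matrix_add_ldistrib)

lemma left_invariant_field_scale:
  "left_invariant_field (c *\<^sub>R x) = (\<lambda>p. c *\<^sub>R left_invariant_field x p)"
  by (auto simp: left_invariant_field_def linear_scale[OF linear_mult_left])

lemma left_invariant_field_in:
  assumes "x \<in> heis_lin"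
  shows "left_invariant_field x \<in> vector_fields heis"
proof -
  have "smooth_map_on heis (left_invariant_field x)"
    by (rule smooth_map_onI[OF smooth_on_linear[OF linear_mult_right[of x, unfolded linear_conv_bounded_linear]]])
      (simp_all add: left_invariant_field_def)
  moreover have "left_invariant_field x g \<in> heis_lin" if g: "g \<in> heis" for g
  proof -
    obtain z where "z \<in> heis_lin" "g = mat 1 + z" using g heis_cases by metis
    then show ?thesis by (simp add: left_invariant_field_eq assms heis_lin_closed center_in)
  qed
  ultimately show ?thesis
    by (simp add: vector_fields_def tangent_space_heis left_invariant_field_def)
qed

text \<open>
  Left and right translations are restrictions of linear maps, which are their own derivatives.
\<close>

lemma pushforward_linear:
  assumes \<phi>: "linear \<phi>" and X: "X \<in> vector_fields heis" and p: "p \<in> \<phi> ` heis" "p \<in> heis"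
  obtains q where "q \<in> heis" "\<phi> q = p" "pushforward heis \<phi> X p = \<phi> (X q)"
proof (rule that)
  show q: "inv_into heis \<phi> p \<in> heis" "\<phi> (inv_into heis \<phi> p) = p"
    using p(1) by (simp_all add: inv_into_into f_inv_into_f)
  have "X (inv_into heis \<phi> p) \<in> heis_lin"
    using X q(1) tangent_space_heis[OF q(1)] by (auto simp: vector_fields_def)
  moreover have "(\<phi> has_derivative \<phi>) (at (inv_into heis \<phi> p) within heis)"
    using \<phi> by (simp add: linear_conv_bounded_linear bounded_linear_imp_has_derivative)
  ultimately show "pushforward heis \<phi> X p = \<phi> (X (inv_into heis \<phi> p))"
    using tangent_deriv_affine[OF subspace_heis_lin, of _ "mat 1"] q(1) p(2)
    unfolding heis_affine by (simp add: pushforward_def)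
qed

lemma pushforward_left:
  assumes g: "g \<in> heis" and x: "x \<in> heis_lin"
  shows "pushforward heis (\<lambda>h. g ** h) (left_invariant_field x) = left_invariant_field x"
proof
  fix p
  show "pushforward heis (\<lambda>h. g ** h) (left_invariant_field x) p = left_invariant_field x p"
  proof (cases "p \<in> heis")
    case True
    obtain g' where g': "g' \<in> heis" "g ** g' = mat 1" using g heis_inverse by metis
    have "p = g ** (g' ** p)" by (simp add: matrix_mul_assoc g'(2))
    then have "p \<in> (\<lambda>h. g ** h) ` heis" using heis_mult_closed[OF g'(1) True] by blast
    then obtain q where "q \<in> heis" "g ** q = p"
      "pushforward heis (\<lambda>h. g ** h) (left_invariant_field x) p = g ** left_invariant_field x q"
      using pushforward_linear[OF linear_mult_left left_invariant_field_in[OF x]] True by metis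
    then show ?thesis using True by (auto simp: left_invariant_field_def matrix_mul_assoc)
  qed (simp add: pushforward_def left_invariant_field_def)
qed

text \<open>
  Right translation by \<open>g = 1 + z\<close> acts on the Lie algebra by \<open>x \<mapsto> g\<inverse> x g\<close>. Brackets are
  central, so this is \<open>x + [x, z]\<close> without higher terms.
\<close>

lemma pushforward_right:
  assumes z: "z \<in> heis_lin" and x: "x \<in> heis_lin"
  shows "pushforward heis (\<lambda>h. h ** (mat 1 + z)) (left_invariant_field x) =
    left_invariant_field (x + mat_bracket x z)"
proof
  fix p
  have g: "mat 1 + z \<in> heis" using z by (simp add: heis_iff)
  have br: "x + mat_bracket x z \<in> heis_lin"
    unfolding mat_bracket_heis[OF x z] by (intro heis_lin_closed x center_in)
  have ad: "x ** (mat 1 + z) = (mat 1 + z) ** (x + mat_bracket x z)"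
    unfolding heis_action[OF z br] unfolding matrix_add_ldistrib
    by (simp add: mat_bracket_heis x z heis_mult heis_dot_simps algebra_simps)
  show "pushforward heis (\<lambda>h. h ** (mat 1 + z)) (left_invariant_field x) p =
    left_invariant_field (x + mat_bracket x z) p"
  proof (cases "p \<in> heis")
    case True
    obtain g' where g': "g' \<in> heis" "g' ** (mat 1 + z) = mat 1" using g heis_inverse by metis
    have "p = (p ** g') ** (mat 1 + z)" by (simp add: matrix_mul_assoc[symmetric] g'(2))
    then have "p \<in> (\<lambda>h. h ** (mat 1 + z)) ` heis" using heis_mult_closed[OF True g'(1)] by blast
    then obtain q where "q \<in> heis" "q ** (mat 1 + z) = p"
      "pushforward heis (\<lambda>h. h ** (mat 1 + z)) (left_invariant_field x) p =
        left_invariant_field x q ** (mat 1 + z)"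
      using pushforward_linear[OF linear_mult_right left_invariant_field_in[OF x]] True by metis
    then show ?thesis using True ad
      by (auto simp: left_invariant_field_def matrix_mul_assoc[symmetric])
  qed (simp add: pushforward_def left_invariant_field_def)
qed

lemma heis_W_entry:
  fixes w :: "'n::finite hmat"
  assumes "w \<in> heis_W"
  shows "w $ First $ Last = 0"
proof -
  have "subspace {w :: 'n hmat. w $ First $ Last = 0}" by (auto simp: subspace_def)
  then have "heis_W \<subseteq> {w :: 'n hmat. w $ First $ Last = 0}"
    unfolding heis_W_def by (intro span_minimal) (auto simp: unit_mat_def)
  then show ?thesis using assms by blast
qed

lemma W_part_heis:
  assumes x: "x \<in> heis_lin"
  shows "W_part x = x - (x $ First $ Last) *\<^sub>R center_vec"
  unfolding W_part_def
proof (rule the_equality)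
  let ?w = "(\<Sum>k\<in>UNIV. (x $ First $ Mid k) *\<^sub>R unit_mat First (Mid k)) +
    (\<Sum>k\<in>UNIV. (x $ Mid k $ Last) *\<^sub>R unit_mat (Mid k) Last)"
  have "?w \<in> heis_W"
    unfolding heis_W_def by (intro span_add span_sum span_scale span_base) auto
  moreover have w: "?w \<in> heis_lin"
    by (intro heis_lin_closed(1) subspace_sum[OF subspace_heis_lin] heis_lin_closed(3) unit_mat_in)
  have "x - (x $ First $ Last) *\<^sub>R center_vec = ?w"
    by (subst heis_lin_eq_iff[OF heis_lin_closed(2)[OF x heis_lin_closed(3)[OF center_in]] w])
      (simp add: unit_mat_def mult_delta_right)
  ultimately have "x - (x $ First $ Last) *\<^sub>R center_vec \<in> heis_W" by metis
  then show "x - (x $ First $ Last) *\<^sub>R center_vec \<in> heis_W \<and>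
      x - (x - (x $ First $ Last) *\<^sub>R center_vec) \<in> heis_V"
    by (simp add: heis_V_def span_scale span_base)
next
  fix w assume w: "w \<in> heis_W \<and> x - w \<in> heis_V"
  then obtain c where c: "x - w = c *\<^sub>R center_vec" by (auto simp: heis_V_def span_singleton)
  have "w $ First $ Last = 0" using w heis_W_entry by blast
  moreover have "(x - w) $ First $ Last = c" unfolding c by (simp add: unit_mat_def)
  ultimately have "c = x $ First $ Last" by simp
  then show "w = x - (x $ First $ Last) *\<^sub>R center_vec" using c by (simp add: algebra_simps)
qed

section \<open>Biinvariant torsion-free connections on the Heisenberg group\<close>

locale heis_connection =
  fixes nabla :: "'n::finite hmat connection"
  assumes koszul: "koszul_connection heis nabla"
    and biinv: "biinvariant nabla"
    and torsion: "torsion_free heis nabla"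
begin

text \<open>
  The bilinear product on the Lie algebra that determines a left invariant connection, extended
  through the projection to a bilinear map on all matrices.
\<close>

definition mu :: "'n hmat \<Rightarrow> 'n hmat \<Rightarrow> 'n hmat" where
  "mu x y = nabla (left_invariant_field (heis_proj x)) (left_invariant_field (heis_proj y)) (mat 1)"

lemmas LF = left_invariant_field_in

lemma nabla_in: "X \<in> vector_fields heis \<Longrightarrow> Y \<in> vector_fields heis \<Longrightarrow> nabla X Y \<in> vector_fields heis"
  using koszul unfolding koszul_connection_def by blast

lemma nabla_add_left:
  "X \<in> vector_fields heis \<Longrightarrow> X' \<in> vector_fields heis \<Longrightarrow> Y \<in> vector_fields heis \<Longrightarrow>
    nabla (\<lambda>p. X p + X' p) Y = (\<lambda>p. nabla X Y p + nabla X' Y p)"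
  using koszul unfolding koszul_connection_def by blast

lemma nabla_scale_left:
  "smooth_map_on heis f \<Longrightarrow> X \<in> vector_fields heis \<Longrightarrow> Y \<in> vector_fields heis \<Longrightarrow>
    nabla (\<lambda>p. f p *\<^sub>R X p) Y = (\<lambda>p. f p *\<^sub>R nabla X Y p)"
  using koszul unfolding koszul_connection_def by blast

lemma nabla_add_right:
  "X \<in> vector_fields heis \<Longrightarrow> Y \<in> vector_fields heis \<Longrightarrow> Y' \<in> vector_fields heis \<Longrightarrow>
    nabla X (\<lambda>p. Y p + Y' p) = (\<lambda>p. nabla X Y p + nabla X Y' p)"
  using koszul unfolding koszul_connection_def by blast

lemma nabla_scale_right:
  "smooth_map_on heis f \<Longrightarrow> X \<in> vector_fields heis \<Longrightarrow> Y \<in> vector_fields heis \<Longrightarrow>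
    nabla X (\<lambda>p. f p *\<^sub>R Y p) =
      (\<lambda>p. tangent_deriv heis f p (X p) *\<^sub>R Y p + f p *\<^sub>R nabla X Y p)"
  using koszul unfolding koszul_connection_def by blast

lemma mu_in: "mu x y \<in> heis_lin"
  using nabla_in[OF LF LF, OF heis_proj_in heis_proj_in, of x y] tangent_space_heis[OF one_in_heis]
    one_in_heis unfolding mu_def vector_fields_def by blast

lemma nabla_left_invariant:
  assumes x: "x \<in> heis_lin" and y: "y \<in> heis_lin"
  shows "nabla (left_invariant_field x) (left_invariant_field y) = left_invariant_field (mu x y)"
proof
  fix g
  let ?Y = "nabla (left_invariant_field x) (left_invariant_field y)"
  have Y: "?Y \<in> vector_fields heis" by (rule nabla_in[OF LF[OF x] LF[OF y]])
  have one: "?Y (mat 1) = mu x y" by (simp add: mu_def heis_proj_ident x y)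
  show "?Y g = left_invariant_field (mu x y) g"
  proof (cases "g \<in> heis")
    case True
    have "pushforward heis (\<lambda>h. g ** h) ?Y =
        nabla (pushforward heis (\<lambda>h. g ** h) (left_invariant_field x))
          (pushforward heis (\<lambda>h. g ** h) (left_invariant_field y))"
      using biinv True LF[OF x] LF[OF y] unfolding biinvariant_def invariant_under_def by metis
    then have inv: "pushforward heis (\<lambda>h. g ** h) ?Y = ?Y"
      by (simp add: pushforward_left True x y)
    have "g \<in> (\<lambda>h. g ** h) ` heis" using one_in_heis by (auto intro: image_eqI[of _ _ "mat 1"])
    then obtain q where q: "g ** q = g" "pushforward heis (\<lambda>h. g ** h) ?Y g = g ** ?Y q"
      using pushforward_linear[OF linear_mult_left Y _ True] by metis
    obtain g' where "g' ** g = mat 1" using heis_inverse[OF True] by metis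
    then have "q = mat 1" using q(1) by (metis matrix_mul_assoc matrix_mul_lid)
    then show ?thesis using q(2) inv one True by (simp add: left_invariant_field_def)
  next
    case False
    then show ?thesis using Y by (simp add: vector_fields_def left_invariant_field_def)
  qed
qed

lemma mu_Ad:
  assumes x: "x \<in> heis_lin" and y: "y \<in> heis_lin" and z: "z \<in> heis_lin"
  shows "mu (x + mat_bracket x z) (y + mat_bracket y z) = mu x y + mat_bracket (mu x y) z"
proof -
  let ?R = "pushforward heis (\<lambda>h. h ** (mat 1 + z))"
  have g: "mat 1 + z \<in> heis" using z by (simp add: heis_iff)
  have br: "x + mat_bracket x z \<in> heis_lin" if "x \<in> heis_lin" for x
    unfolding mat_bracket_heis[OF that z] by (intro heis_lin_closed that center_in)
  have "nabla (?R (left_invariant_field x)) (?R (left_invariant_field y)) =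
      ?R (nabla (left_invariant_field x) (left_invariant_field y))"
    using biinv g LF[OF x] LF[OF y] unfolding biinvariant_def invariant_under_def by metis
  then have "left_invariant_field (mu (x + mat_bracket x z) (y + mat_bracket y z)) =
      left_invariant_field (mu x y + mat_bracket (mu x y) z)"
    by (simp add: pushforward_right x y z mu_in nabla_left_invariant br)
  then show ?thesis by (metis left_invariant_field_at_one)
qed

lemma bilinear_mu: "bilinear mu"
proof -
  have P: "left_invariant_field (heis_proj x) \<in> vector_fields heis" for x :: "'n hmat"
    by (rule LF[OF heis_proj_in])
  have c: "smooth_map_on heis (\<lambda>p :: 'n hmat. c)" for c :: real
    by (rule smooth_map_onI[OF smooth_on_const]) simp
  have "tangent_deriv heis (\<lambda>p. c) p (left_invariant_field (heis_proj x) p) = 0"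
    if "p \<in> heis" for c :: real and x p :: "'n hmat"
    using tangent_deriv_affine[OF subspace_heis_lin, of p "mat 1" _ "\<lambda>p. c" "\<lambda>v. 0"]
      P[of x] that tangent_space_heis[OF that]
    by (auto simp: heis_affine[symmetric] vector_fields_def)
  then show ?thesis
    unfolding bilinear_def
    by (auto intro!: linearI simp: mu_def one_in_heis linear_add[OF linear_heis_proj]
        linear_scale[OF linear_heis_proj] left_invariant_field_add left_invariant_field_scale
        nabla_add_left nabla_add_right nabla_scale_left[OF c] nabla_scale_right[OF c] P)
qed

lemmas mu_simps = bilinear_ladd[OF bilinear_mu] bilinear_radd[OF bilinear_mu]
  bilinear_lmul[OF bilinear_mu] bilinear_rmul[OF bilinear_mu]
  bilinear_lneg[OF bilinear_mu] bilinear_rneg[OF bilinear_mu]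
  bilinear_lsub[OF bilinear_mu] bilinear_rsub[OF bilinear_mu]

lemma mu_torsion:
  assumes x: "x \<in> heis_lin" and y: "y \<in> heis_lin"
  shows "mu x y - mu y x = mat_bracket x y"
proof -
  have d: "tangent_deriv heis (left_invariant_field v) (mat 1) u = u ** v"
    if "u \<in> heis_lin" for u v :: "'n hmat"
  proof -
    have "((\<lambda>h. h ** v) has_derivative (\<lambda>h. h ** v)) (at (mat 1) within heis)"
      using linear_mult_right[of v]
      by (simp add: linear_conv_bounded_linear bounded_linear_imp_has_derivative)
    then have "(left_invariant_field v has_derivative (\<lambda>h. h ** v)) (at (mat 1) within heis)"
      by (rule has_derivative_transform[OF one_in_heis, rotated])
        (simp add: left_invariant_field_def)
    then show ?thesis
      using tangent_deriv_affine[OF subspace_heis_lin _ that] one_in_heis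
      unfolding heis_affine by blast
  qed
  have "(\<lambda>p. nabla (left_invariant_field x) (left_invariant_field y) p -
      nabla (left_invariant_field y) (left_invariant_field x) p) =
      vf_bracket heis (left_invariant_field x) (left_invariant_field y)"
    using torsion LF[OF x] LF[OF y] unfolding torsion_free_def by blast
  from fun_cong[OF this, of "mat 1"] show ?thesis
    unfolding nabla_left_invariant[OF x y] nabla_left_invariant[OF y x] left_invariant_field_at_one
    by (simp add: vf_bracket_def one_in_heis bracket_at_def left_invariant_field_at_one d[OF x] d[OF y]
        mat_bracket_def)
qed

text \<open>
  Both sides of the invariance of \<open>mu\<close> under \<open>x \<mapsto> x + [x, z]\<close>, with \<open>[x, z]\<close> written as the
  multiple \<open>om x z\<close> of the central vector. The left side has a linear and a quadratic part in
  \<open>z\<close>, the right side is linear.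
\<close>

lemma mu_Ad_expanded:
  assumes x: "x \<in> heis_lin" and y: "y \<in> heis_lin" and z: "z \<in> heis_lin"
  defines "om \<equiv> \<lambda>u v. heis_dot u v - heis_dot v u"
  shows "om y z *\<^sub>R mu x center_vec + om x z *\<^sub>R mu center_vec y +
    (om x z * om y z) *\<^sub>R mu center_vec center_vec = om (mu x y) z *\<^sub>R center_vec"
  using mu_Ad[OF x y z]
  unfolding om_def by (simp add: mat_bracket_heis x y z mu_in mu_simps algebra_simps)

text \<open>Adding the invariance equations for \<open>z\<close> and \<open>- z\<close> isolates the quadratic part.\<close>

lemma mu_center_center: "mu center_vec center_vec = 0"
proof -
  define x :: "'n hmat" where "x = unit_mat First (Mid undefined)"
  define z :: "'n hmat" where "z = unit_mat (Mid undefined) Last"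
  have x: "x \<in> heis_lin" and z: "z \<in> heis_lin" by (simp_all add: x_def z_def unit_mat_in)
  have om: "heis_dot x z = 1" "heis_dot z x = 0"
    by (simp_all add: x_def z_def) (simp add: unit_mat_def)
  define k where "k = heis_dot (mu x x) z - heis_dot z (mu x x)"
  have "(mu x center_vec + mu center_vec x) + mu center_vec center_vec = k *\<^sub>R center_vec"
    using mu_Ad_expanded[OF x x z] by (simp add: om k_def)
  moreover have "- (mu x center_vec + mu center_vec x) + mu center_vec center_vec =
      - (k *\<^sub>R center_vec)"
    using mu_Ad_expanded[OF x x heis_lin_closed(4)[OF z]]
    by (simp add: om k_def heis_dot_simps algebra_simps)
  moreover have "2 *\<^sub>R c = (a + c) + (- a + c)" for a c :: "'n hmat"
    by (simp add: scaleR_2)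
  ultimately have "2 *\<^sub>R mu center_vec center_vec = 0" by (metis add.right_inverse)
  then show ?thesis by simp
qed

text \<open>
  With \<open>y\<close> the central vector, the invariance equation says that \<open>mu x y\<close> is central again; its
  coefficient is the linear form of the theorem.
\<close>

definition lform :: "'n hmat \<Rightarrow> real" where
  "lform x = mu x center_vec $ First $ Last"

lemma mu_center_right:
  assumes x: "x \<in> heis_lin"
  shows "mu x center_vec = lform x *\<^sub>R center_vec"
proof -
  have "heis_dot (mu x center_vec) z - heis_dot z (mu x center_vec) = 0" if z: "z \<in> heis_lin" for z
  proof -
    show ?thesis using mu_Ad_expanded[OF x center_in z] by (simp add: mu_center_center)
  qed
  then show ?thesis unfolding lform_def by (rule heis_central[OF mu_in])
qed

lemma mu_center_left:
  assumes x: "x \<in> heis_lin"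
  shows "mu center_vec x = lform x *\<^sub>R center_vec"
  using mu_torsion[OF x center_in] mu_center_right[OF x]
  by (simp add: mat_bracket_heis x center_in)

lemma linear_lform: "linear lform"
  by (rule linearI) (simp_all add: lform_def mu_simps)

lemma lform_center: "lform center_vec = 0"
  by (simp add: lform_def mu_center_center)

lemma mu_proj: "mu (heis_proj x) y = mu x y" "mu x (heis_proj y) = mu x y"
  by (simp_all add: mu_def heis_proj_ident[OF heis_proj_in])

text \<open>What remains of \<open>mu\<close> after removing the other terms of the formula to be proved.\<close>

definition Omega :: "'n hmat \<Rightarrow> 'n hmat \<Rightarrow> 'n hmat" where
  "Omega x y = mu x y - ((heis_dot x y - heis_dot y x) / 2) *\<^sub>R center_vec -
     lform x *\<^sub>R heis_proj y - lform y *\<^sub>R heis_proj x"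

lemma Omega_proj: "Omega (heis_proj x) (heis_proj y) = Omega x y"
  by (simp add: Omega_def mu_proj heis_dot_proj lform_def heis_proj_ident[OF heis_proj_in])

lemma bilinear_Omega: "bilinear Omega"
  unfolding bilinear_def
  by (auto intro!: linearI simp: Omega_def mu_simps heis_dot_simps linear_add[OF linear_lform]
      linear_scale[OF linear_lform] linear_add[OF linear_heis_proj] linear_scale[OF linear_heis_proj]
      algebra_simps add_divide_distrib diff_divide_distrib)

lemma Omega_center: "Omega x center_vec = 0"
proof -
  have "Omega (heis_proj x) center_vec = 0"
    by (simp add: Omega_def mu_center_right[OF heis_proj_in] lform_center heis_proj_ident[OF center_in])
  then show ?thesis using Omega_proj[of "heis_proj x" center_vec] Omega_proj[of x center_vec]
    by (simp add: heis_proj_ident[OF heis_proj_in])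
qed

lemma Omega_sym: "Omega x y = Omega y x"
proof -
  have "Omega u v = Omega v u" if u: "u \<in> heis_lin" and v: "v \<in> heis_lin" for u v
  proof -
    define k where "k = (heis_dot u v - heis_dot v u) / 2"
    have k: "heis_dot u v - heis_dot v u = k + k" "(heis_dot v u - heis_dot u v) / 2 = - k"
      by (simp_all add: k_def field_simps)
    have "mu u v = mu v u + (k + k) *\<^sub>R center_vec"
      using mu_torsion[OF u v] unfolding mat_bracket_heis[OF u v] k by (simp add: algebra_simps)
    moreover have "A - E - p - q = C + E - q - p" if "A = C + (E + E)" for A C E p q :: "'n hmat"
      using that by simp
    ultimately show ?thesis
      unfolding Omega_def k_def[symmetric] k(2) scaleR_add_left scaleR_minus_left diff_minus_eq_add
      by blast
  qed
  from this[OF heis_proj_in heis_proj_in, of x y] show ?thesis by (simp add: Omega_proj)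
qed

text \<open>
  Now that products with the central vector are known, the invariance equation reads
  \<open>[lform x * y + lform y * x, z] = [mu x y, z]\<close> for all \<open>z\<close>. So the difference of the two
  first arguments commutes with the whole Lie algebra and is therefore central.
\<close>

lemma Omega_central: "Omega x y = (Omega x y $ First $ Last) *\<^sub>R center_vec"
proof -
  have *: "Omega u v = (Omega u v $ First $ Last) *\<^sub>R center_vec"
    if u: "u \<in> heis_lin" and v: "v \<in> heis_lin" for u v
  proof (rule heis_central)
    have Omega_eq: "Omega u v = mu u v - ((heis_dot u v - heis_dot v u) / 2) *\<^sub>R center_vec -
        lform u *\<^sub>R v - lform v *\<^sub>R u"
      by (simp add: Omega_def heis_proj_ident u v)
    show "Omega u v \<in> heis_lin"
      unfolding Omega_eq by (intro heis_lin_closed mu_in center_in u v)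
    fix z :: "'n hmat" assume z: "z \<in> heis_lin"
    define m where "m = heis_dot (mu u v) z - heis_dot z (mu u v)"
    have "(heis_dot v z - heis_dot z v) *\<^sub>R (lform u *\<^sub>R center_vec) +
        (heis_dot u z - heis_dot z u) *\<^sub>R (lform v *\<^sub>R center_vec) = m *\<^sub>R (center_vec :: 'n hmat)"
      using mu_Ad_expanded[OF u v z]
      by (simp add: mu_center_center mu_center_left mu_center_right u v m_def)
    then have "((heis_dot v z - heis_dot z v) * lform u + (heis_dot u z - heis_dot z u) * lform v)
        *\<^sub>R center_vec = m *\<^sub>R (center_vec :: 'n hmat)"
      by (simp add: scaleR_add_left)
    then have "(heis_dot v z - heis_dot z v) * lform u + (heis_dot u z - heis_dot z u) * lform v = m"
      by simp
    then show "heis_dot (Omega u v) z - heis_dot z (Omega u v) = 0"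
      by (simp add: Omega_eq heis_dot_simps m_def algebra_simps)
  qed
  from *[OF heis_proj_in heis_proj_in, of x y] show ?thesis by (simp add: Omega_proj)
qed

text \<open>
  In the frame of constant fields the Christoffel symbols are constant. The constant field with
  value \<open>u\<close> differs from the left invariant one by \<open>- heis_dot (g - 1) u\<close> times the invariant
  central field. Differentiating this coefficient adds \<open>- heis_dot u v\<close> to the central part, which
  turns the half of the bracket contained in \<open>mu\<close> into a symmetric form.
\<close>

definition christoffel_center :: "'n hmat \<Rightarrow> 'n hmat \<Rightarrow> 'n hmat" where
  "christoffel_center u v = ((heis_dot u v + heis_dot v u) / 2) *\<^sub>R center_vec - Omega u v"

definition christoffel :: "'n hmat \<Rightarrow> 'n hmat \<Rightarrow> 'n hmat" where
  "christoffel u v = lform u *\<^sub>R v + lform v *\<^sub>R u - christoffel_center u v"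

lemma bilinear_christoffel_center: "bilinear christoffel_center"
  unfolding bilinear_def
  by (auto intro!: linearI simp: christoffel_center_def heis_dot_simps bilinear_ladd[OF bilinear_Omega]
      bilinear_radd[OF bilinear_Omega] bilinear_lmul[OF bilinear_Omega] bilinear_rmul[OF bilinear_Omega]
      algebra_simps add_divide_distrib)

lemma christoffel_center_central:
  "christoffel_center u v = (christoffel_center u v $ First $ Last) *\<^sub>R center_vec"
proof -
  have "christoffel_center u v = ((heis_dot u v + heis_dot v u) / 2 - Omega u v $ First $ Last) *\<^sub>R center_vec"
    unfolding christoffel_center_def by (subst Omega_central) (simp add: algebra_simps)
  then show ?thesis by (simp add: unit_mat_def)
qed

lemma nabla_constant_field:
  assumes u: "u \<in> heis_lin" and v: "v \<in> heis_lin"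
  shows "nabla (constant_field heis u) (constant_field heis v) =
    constant_field heis (christoffel u v)"
proof
  define f where "f x p = - heis_dot (p - mat 1) x" for x p :: "'n hmat"
  let ?L = "left_invariant_field :: 'n hmat \<Rightarrow> _" and ?C = "constant_field heis"
  let ?e = "center_vec :: 'n hmat"
  have C: "?C x = (\<lambda>p. ?L x p + f x p *\<^sub>R ?L ?e p)" if x: "x \<in> heis_lin" for x
  proof
    fix p show "?C x p = ?L x p + f x p *\<^sub>R ?L ?e p"
    proof (cases "p \<in> heis")
      case True
      then obtain z where z: "z \<in> heis_lin" "p = mat 1 + z" by (rule heis_cases)
      then show ?thesis using True
        by (simp add: constant_field_def f_def left_invariant_field_eq x center_in)
    qed (simp add: constant_field_def left_invariant_field_def)
  qed
  have lin: "bounded_linear (\<lambda>p. heis_dot p x)" for x :: "'n hmat"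
    by (metis bilinear_heis_dot bilinear_def linear_conv_bounded_linear)
  have f: "smooth_map_on heis (f x)" for x
  proof (rule smooth_map_onI)
    show "smooth_on UNIV (\<lambda>p. heis_dot (mat 1) x - heis_dot p x)"
      by (intro smooth_on_diff open_UNIV smooth_on_const smooth_on_linear lin)
  qed (simp add: f_def heis_dot_simps)
  have df: "tangent_deriv heis (f v) p (?C u p) = - heis_dot u v" if "p \<in> heis" for p
  proof -
    have "((\<lambda>p. heis_dot (mat 1) v - heis_dot p v) has_derivative (\<lambda>w. 0 - heis_dot w v))
        (at p within heis)"
      by (intro has_derivative_diff has_derivative_const bounded_linear_imp_has_derivative lin)
    then have "(f v has_derivative (\<lambda>w. - heis_dot w v)) (at p within heis)"
      by (simp add: f_def[abs_def] heis_dot_simps)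
    then show ?thesis
      using tangent_deriv_affine[OF subspace_heis_lin _ u] that
      unfolding heis_affine by (auto simp: constant_field_def)
  qed
  have CF: "?C u \<in> vector_fields heis" and CF': "?C v \<in> vector_fields heis"
    unfolding heis_affine by (rule constant_field_in_vector_fields[OF subspace_heis_lin] u v)+
  note LF' = LF[OF u] LF[OF v] LF[OF center_in]
  have scaled: "(\<lambda>p. f x p *\<^sub>R ?L ?e p) \<in> vector_fields heis" if "x \<in> heis_lin" for x
  proof -
    have "smooth_map_on heis (\<lambda>p. f x p *\<^sub>R ?L ?e p)"
    proof (rule smooth_map_onI)
      show "smooth_on UNIV (\<lambda>p. (heis_dot (mat 1) x - heis_dot p x) *\<^sub>R (p ** ?e))"
        by (intro smooth_on_bounded_bilinear[OF bounded_bilinear_scaleR] open_UNIV smooth_on_diff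
            smooth_on_const smooth_on_linear lin linear_mult_right[unfolded linear_conv_bounded_linear])
    qed (simp add: f_def heis_dot_simps left_invariant_field_def)
    then show ?thesis
      using LF[OF center_in] by (auto simp: vector_fields_def tangent_space_heis heis_lin_closed)
  qed
  have left: "nabla (?C u) (?L y) = (\<lambda>p. ?L (mu u y) p + f u p *\<^sub>R ?L (mu ?e y) p)"
    if y: "y \<in> heis_lin" for y
    unfolding C[OF u] nabla_add_left[OF LF'(1) scaled[OF u] LF[OF y]]
      nabla_scale_left[OF f LF'(3) LF[OF y]]
    by (simp add: nabla_left_invariant u y center_in)
  fix p
  have "nabla (?C u) (?C v) = (\<lambda>p. nabla (?C u) (?L v) p +
      (tangent_deriv heis (f v) p (?C u p) *\<^sub>R ?L ?e p + f v p *\<^sub>R nabla (?C u) (?L ?e) p))"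
    unfolding C[OF v] nabla_add_right[OF CF LF'(2) scaled[OF v]] nabla_scale_right[OF f CF LF'(3)] ..
  then have N: "nabla (?C u) (?C v) p = ?L (mu u v) p + f u p *\<^sub>R ?L (mu ?e v) p +
      (tangent_deriv heis (f v) p (?C u p) *\<^sub>R ?L ?e p +
        f v p *\<^sub>R (?L (mu u ?e) p + f u p *\<^sub>R ?L (mu ?e ?e) p))"
    by (simp add: left v center_in)
  show "nabla (?C u) (?C v) p = ?C (christoffel u v) p"
  proof (cases "p \<in> heis")
    case True
    then obtain z where z: "z \<in> heis_lin" "p = mat 1 + z" by (rule heis_cases)
    have mu: "mu u v = Omega u v + ((heis_dot u v - heis_dot v u) / 2) *\<^sub>R ?e +
        lform u *\<^sub>R v + lform v *\<^sub>R u"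
      by (simp add: Omega_def heis_proj_ident u v)
    have "heis_dot z (Omega u v) = 0" by (subst Omega_central) (simp add: heis_dot_simps)
    then have zmu: "heis_dot z (mu u v) = lform u * heis_dot z v + lform v * heis_dot z u"
      unfolding mu by (simp add: heis_dot_simps)
    have Le: "?L (c *\<^sub>R ?e) p = c *\<^sub>R ?e" for c
      unfolding z(2) by (simp add: left_invariant_field_eq z(1) center_in heis_lin_closed heis_dot_simps)
    have "nabla (?C u) (?C v) p = mu u v - heis_dot u v *\<^sub>R ?e"
      unfolding N df[OF True] mu_center_left[OF v] mu_center_right[OF u] mu_center_center
        Le Le[of 1, simplified] Le[of 0, simplified]
      unfolding z(2) left_invariant_field_eq[OF z(1) mu_in] zmu by (simp add: f_def algebra_simps)
    also have "\<dots> = christoffel u v"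
    proof -
      have "(heis_dot u v - heis_dot v u) / 2 = heis_dot u v - (heis_dot u v + heis_dot v u) / 2"
        by (simp add: field_simps)
      then show ?thesis
        unfolding mu christoffel_def christoffel_center_def by (simp only: scaleR_left_diff_distrib) simp
    qed
    finally show ?thesis using True by (simp add: constant_field_def)
  next
    case False
    have "nabla (?C u) (?C v) p = 0"
      using nabla_in[OF CF CF'] False by (simp add: vector_fields_def)
    then show ?thesis using False by (simp add: constant_field_def[of heis "christoffel u v"])
  qed
qed

lemma P_complete_heis: "P_complete heis nabla"
proof -
  interpret quadratic_geodesics heis_lin lform christoffel_center
  proof (rule quadratic_geodesics.intro)
    show "bounded_linear lform" using linear_lform by (simp add: linear_conv_bounded_linear)
    show "bounded_bilinear christoffel_center"
      using bilinear_christoffel_center by (simp add: bilinear_conv_bounded_bilinear)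
    show "christoffel_center u v = christoffel_center v u" for u v
      by (simp add: christoffel_center_def add.commute Omega_sym[of u v])
    show "christoffel_center u v \<in> heis_lin" for u v
      by (subst christoffel_center_central) (intro heis_lin_closed center_in)
    show "lform (christoffel_center u v) = 0" for u v
      by (subst christoffel_center_central) (simp add: linear_scale[OF linear_lform] lform_center)
    have "christoffel_center w center_vec = 0" for w by (simp add: christoffel_center_def Omega_center)
    then show "christoffel_center w (christoffel_center u v) = 0" for u v w
      by (subst christoffel_center_central[of u v]) (simp add: bilinear_rmul[OF bilinear_christoffel_center])
  qed (rule subspace_heis_lin)
  have G: "linear (christoffel u)" for u
    by (rule linearI) (simp_all add: christoffel_def linear_add[OF linear_lform]
        linear_scale[OF linear_lform] bilinear_radd[OF bilinear_christoffel_center]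
        bilinear_rmul[OF bilinear_christoffel_center] algebra_simps)
  show ?thesis
    unfolding heis_affine
  proof (rule P_complete_affine)
    fix I \<gamma> t
    assume "geodesic_on (affine_manifold (mat 1) heis_lin) nabla I \<gamma>" "t \<in> I"
    from geodesic_equation_constant_symbols[OF subspace_heis_lin
        nabla_constant_field[unfolded heis_affine] G refl this]
    show "(velocity \<gamma> has_vector_derivative - (2 * lform (velocity \<gamma> t)) *\<^sub>R velocity \<gamma> t +
        christoffel_center (velocity \<gamma> t) (velocity \<gamma> t)) (at t)"
      by (simp add: christoffel_def scaleR_2[symmetric] algebra_simps)
  qed
qed

lemma left_invariant_formula:
  assumes x: "x \<in> heis_alg" and y: "y \<in> heis_alg"
  shows "nabla (left_invariant_field x) (left_invariant_field y) =
    left_invariant_field ((1/2) *\<^sub>R mat_bracket x y + lform (W_part x) *\<^sub>R y +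
      lform (W_part y) *\<^sub>R x + Omega (W_part x) (W_part y))"
proof -
  have xy: "x \<in> heis_lin" "y \<in> heis_lin" using x y by (simp_all add: heis_alg_eq)
  have l: "lform (W_part w) = lform w" if "w \<in> heis_lin" for w
    by (simp add: W_part_heis that linear_diff[OF linear_lform] linear_scale[OF linear_lform] lform_center)
  have "Omega center_vec w = 0" for w by (simp add: Omega_sym[of center_vec] Omega_center)
  then have "Omega (W_part x) (W_part y) = Omega x y"
    by (simp add: W_part_heis xy bilinear_lsub[OF bilinear_Omega] bilinear_rsub[OF bilinear_Omega]
        bilinear_lmul[OF bilinear_Omega] bilinear_rmul[OF bilinear_Omega] Omega_center)
  then show ?thesis
    by (simp add: nabla_left_invariant xy l Omega_def heis_proj_ident mat_bracket_heis)
qed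

end

theorem theorem10p3:
  fixes nabla :: "('n::finite) hmat connection"
  assumes "koszul_connection heis nabla"
    and "biinvariant nabla"
    and "torsion_free heis nabla"
  shows "(\<exists>l\<in>dual_on heis_W. \<exists>\<Omega>. symmetric_bilinear_on heis_W heis_V \<Omega> \<and>
            (\<forall>x\<in>heis_alg. \<forall>y\<in>heis_alg.
               nabla (left_invariant_field x) (left_invariant_field y) =
               left_invariant_field
                 ((1/2) *\<^sub>R mat_bracket x y + l (W_part x) *\<^sub>R y + l (W_part y) *\<^sub>R x
                   + \<Omega> (W_part x) (W_part y)))) \<and>
         P_complete heis nabla"
proof -
  interpret heis_connection nabla using assms by unfold_locales
  have "lform \<in> dual_on heis_W"
    by (simp add: dual_on_def linear_add[OF linear_lform] linear_scale[OF linear_lform])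
  moreover have "Omega x y \<in> heis_V" for x y
    unfolding heis_V_def by (subst Omega_central) (intro span_scale span_base, simp)
  then have "symmetric_bilinear_on heis_W heis_V Omega"
    unfolding symmetric_bilinear_on_def bilinear_ladd[OF bilinear_Omega] bilinear_lmul[OF bilinear_Omega]
    using Omega_sym by blast
  ultimately show ?thesis
    using left_invariant_formula P_complete_heis by blast
qed

end
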